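(* If $G$ is a connected planar graph of order at least $2$, then \[ \operatorname{lpt}(G)\leq 9\sqrt{|V(G)|}\,\log |V(G)| . \]
   Context: All graphs are simple, finite, and undirected; the order of a graph (or of a path) is its number of vertices. A longest path of a graph $G$ is a path in $G$ of maximum order among all paths in $G$. A longest path transversal of $G$ is a set of vertices of $G$ that intersects the vertex set of every longest path of $G$. $\operatorname{lpt}(G)$ denotes the minimum cardinality of a longest path transversal of $G$. Here $\log$ denotes the natural logarithm. *)

theory Defs
  imports
    "HOL-Analysis.Analysis"
    "Graph_Theory.Digraph_Component"
    "Graph_Theory.Vertex_Walk"
begin

text \<open>
  A simple finite undirected graph is a \<^const>\<open>graph\<close>, i.e. a finite, loop-free, symmetric digraph
  without parallel arcs; a path is a \<^const>\<open>vpath\<close>, i.e. a nonempty list of distinct vertices, and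
  its order is the length of the list.
\<close>

text \<open>The arcs \<open>(u, v)\<close> and \<open>(v, u)\<close> represent one and the same undirected edge \<open>{u, v}\<close>.\<close>

definition edge_sets :: "('a, 'b) pre_digraph \<Rightarrow> 'a set set" where
  "edge_sets G = {{u, v} | u v. (u, v) \<in> arcs_ends G}"

definition plane_drawing ::
  "('a, 'b) pre_digraph \<Rightarrow> ('a \<Rightarrow> complex) \<Rightarrow> ('a set \<Rightarrow> real \<Rightarrow> complex) \<Rightarrow> bool" where
  "plane_drawing G pt crv \<longleftrightarrow>
     inj_on pt (verts G) \<and>
     (\<forall>e \<in> edge_sets G.
        arc (crv e) \<and>
        {pathstart (crv e), pathfinish (crv e)} = pt ` e \<and>
        path_image (crv e) \<inter> pt ` verts G = pt ` e) \<and>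
     (\<forall>e \<in> edge_sets G. \<forall>f \<in> edge_sets G. e \<noteq> f \<longrightarrow>
        path_image (crv e) \<inter> path_image (crv f) \<subseteq> pt ` (e \<inter> f))"

definition planar :: "('a, 'b) pre_digraph \<Rightarrow> bool" where
  "planar G \<longleftrightarrow> (\<exists>pt crv. plane_drawing G pt crv)"

definition longest_path :: "'a vwalk \<Rightarrow> ('a, 'b) pre_digraph \<Rightarrow> bool" where
  "longest_path p G \<longleftrightarrow> vpath p G \<and> (\<forall>q. vpath q G \<longrightarrow> length q \<le> length p)"

definition longest_path_transversal :: "'a set \<Rightarrow> ('a, 'b) pre_digraph \<Rightarrow> bool" where
  "longest_path_transversal S G \<longleftrightarrow>
     S \<subseteq> verts G \<and> (\<forall>p. longest_path p G \<longrightarrow> S \<inter> set p \<noteq> {})"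

definition lpt :: "('a, 'b) pre_digraph \<Rightarrow> nat" where
  "lpt G = (LEAST k. \<exists>S. longest_path_transversal S G \<and> card S = k)"

end

theory Submission
  imports Defs
begin

text \<open>
  Any two longest paths of a connected graph share a vertex
  (\<open>longest_paths_meet\<close>): otherwise a path that links them, continued along the longer halves of
  both, would be longer than either. The vertex sets of the longest paths are therefore a family of
  connected, pairwise intersecting sets, and a longest path transversal is a set that hits all of
  them.

  For such a family in a graph on \<open>n\<close> vertices, an argument of Alon, Seymour and Thomas
  (\<open>bramble_hitting_set_or_clique_model\<close>) gives, whenever \<open>h * n \<le> t * t\<close>, either a hitting set of
  at most \<open>h * t\<close> vertices or \<open>h\<close> disjoint connected sets that are pairwise joined by edges, that is,
  a \<open>K_h\<close> minor. The minor is grown one branch set at a time inside a part \<open>B\<close> of the graph that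
  contains a member of the family. Either a small connected subset of \<open>B\<close> touches all branch sets
  found so far and becomes a new one, or a small separator of \<open>B\<close> exists, and one of the branch
  sets can absorb enough of \<open>B\<close> to be cut off from the rest of it by that separator alone. Both
  steps make \<open>B\<close> smaller.

  With \<open>h = 6\<close> the second outcome is impossible in the plane, since \<open>K_6\<close> contains \<open>K_{3,3}\<close>.
  This is proved for minors directly, without passing to a subdivision: four of the six branch
  sets contain a cycle, drawn as a Jordan curve; the other two are joined by an edge and so lie on
  one side of it, where each connects a pair of opposite branch sets of the cycle. Janiszewski's
  theorem forbids such a crossing (\<open>no_crossing_chords\<close>).

  So there is a transversal of at most \<open>6 * t\<close> vertices with \<open>t = \<lceil>sqrt (6 * n)\<rceil>\<close>, which is of order
  \<open>sqrt n\<close>. That is below \<open>9 * sqrt n * ln n\<close> for \<open>n > 36\<close>, and for smaller \<open>n\<close> the set of all vertices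
  is good enough.
\<close>

section \<open>Connected vertex sets\<close>

text \<open>
  Connectivity is stated as a closure condition so that it can be used as an induction principle:
  a property that holds at one vertex of \<open>D\<close> and passes along the edges inside \<open>D\<close> holds on \<open>D\<close>.
\<close>

definition connected_in :: "'a rel \<Rightarrow> 'a set \<Rightarrow> bool" where
  "connected_in E D \<longleftrightarrow> D \<noteq> {} \<and> (\<forall>P\<subseteq>D. P \<noteq> {} \<longrightarrow> E `` P \<inter> D \<subseteq> P \<longrightarrow> P = D)"

lemma connected_in_nonempty: "connected_in E D \<Longrightarrow> D \<noteq> {}"
  by (simp add: connected_in_def)

lemma connected_in_induct [consumes 2, case_names root step]:
  assumes "connected_in E D" "v \<in> D" "r \<in> D" "Q r"
    and step: "\<And>u w. u \<in> D \<Longrightarrow> w \<in> D \<Longrightarrow> (u, w) \<in> E \<Longrightarrow> Q u \<Longrightarrow> Q w"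
  shows "Q v"
proof -
  have "{u \<in> D. Q u} \<subseteq> D" "{u \<in> D. Q u} \<noteq> {}" "E `` {u \<in> D. Q u} \<inter> D \<subseteq> {u \<in> D. Q u}"
    using assms(3,4) step by auto
  then have "{u \<in> D. Q u} = D"
    using assms(1) unfolding connected_in_def by simp
  then show ?thesis
    using \<open>v \<in> D\<close> by blast
qed

text \<open>
  In a symmetric relation the complement of a closed set is closed too, so only closed sets that
  contain a chosen root have to be examined.
\<close>

lemma connected_inI:
  assumes "sym E" "r \<in> D"
    and closed: "\<And>P. P \<subseteq> D \<Longrightarrow> r \<in> P \<Longrightarrow> E `` P \<inter> D \<subseteq> P \<Longrightarrow> P = D"
  shows "connected_in E D"
  unfolding connected_in_def
proof (intro conjI allI impI)
  show "D \<noteq> {}"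
    using \<open>r \<in> D\<close> by blast
next
  fix P assume P: "P \<subseteq> D" "P \<noteq> {}" "E `` P \<inter> D \<subseteq> P"
  show "P = D"
  proof (cases "r \<in> P")
    case True
    then show ?thesis
      using closed P by blast
  next
    case False
    have "E `` (D - P) \<inter> D \<subseteq> D - P"
      using P(3) \<open>sym E\<close> by (auto dest: symD)
    then have "D - P = D"
      using closed[of "D - P"] False \<open>r \<in> D\<close> by blast
    then show ?thesis
      using P by blast
  qed
qed

lemma connected_in_singleton: "sym E \<Longrightarrow> connected_in E {v}"
  by (rule connected_inI[of _ v]) auto

lemma connected_in_insert:
  assumes "sym E" "connected_in E D" "u \<in> D" "(u, v) \<in> E"
  shows "connected_in E (insert v D)"
proof (rule connected_inI[OF \<open>sym E\<close>, of u])
  fix P assume P: "P \<subseteq> insert v D" "u \<in> P" "E `` P \<inter> insert v D \<subseteq> P"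
  have "w \<in> P" if "w \<in> D" for w
    using assms(2) that \<open>u \<in> D\<close> \<open>u \<in> P\<close>
    by (rule connected_in_induct) (use P(3) in blast)
  moreover have "v \<in> P"
    using P(2,3) \<open>(u, v) \<in> E\<close> by blast
  ultimately show "P = insert v D"
    using P(1) by blast
qed (use \<open>u \<in> D\<close> in simp)

lemma connected_in_Un:
  assumes "sym E" "connected_in E C" "connected_in E D" "u \<in> C" "v \<in> D" "(u, v) \<in> E"
  shows "connected_in E (C \<union> D)"
proof (rule connected_inI[OF \<open>sym E\<close>, of u])
  fix P assume P: "P \<subseteq> C \<union> D" "u \<in> P" "E `` P \<inter> (C \<union> D) \<subseteq> P"
  have "v \<in> P"
    using P(2,3) assms(5,6) by blast
  have "x \<in> P" if "x \<in> C" for x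
    using assms(2) that assms(4) P(2) by (rule connected_in_induct) (use P(3) in blast)
  moreover have "x \<in> P" if "x \<in> D" for x
    using assms(3) that assms(5) \<open>v \<in> P\<close> by (rule connected_in_induct) (use P(3) in blast)
  ultimately show "P = C \<union> D"
    using P(1) by blast
qed (use assms in blast)

text \<open>
  The component of \<open>W\<close> that contains \<open>F\<close>, as the least closed set above \<open>F\<close>.
\<close>

lemma connected_in_component:
  assumes "sym E" "connected_in E F" "F \<subseteq> W"
  obtains D where "F \<subseteq> D" "D \<subseteq> W" "connected_in E D" "E `` D \<inter> W \<subseteq> D"
proof
  define D where "D = \<Inter>{P. F \<subseteq> P \<and> P \<subseteq> W \<and> E `` P \<inter> W \<subseteq> P}"
  show "F \<subseteq> D" "D \<subseteq> W"
    using \<open>F \<subseteq> W\<close> by (auto simp: D_def)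
  show closed: "E `` D \<inter> W \<subseteq> D"
    unfolding D_def by blast
  obtain r where r: "r \<in> F"
    using connected_in_nonempty[OF assms(2)] by blast
  show "connected_in E D"
  proof (rule connected_inI[OF \<open>sym E\<close>])
    show "r \<in> D"
      using r \<open>F \<subseteq> D\<close> by blast
    fix P assume P: "P \<subseteq> D" "r \<in> P" "E `` P \<inter> D \<subseteq> P"
    have "v \<in> P" if "v \<in> F" for v
      using assms(2) that r \<open>r \<in> P\<close>
      by (rule connected_in_induct) (use P(3) \<open>F \<subseteq> D\<close> in blast)
    moreover have "E `` P \<inter> W \<subseteq> P" "P \<subseteq> W"
      using closed P \<open>D \<subseteq> W\<close> by blast+
    ultimately have "D \<subseteq> P"
      unfolding D_def by blast
    then show "P = D"
      using P by blast
  qed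
qed

section \<open>Linking several sets or separating them\<close>

text \<open>
  A breadth-first search through \<open>k\<close> stacked copies of \<open>B\<close>. Being at the state \<open>(v, i)\<close> means that
  a walk in \<open>B\<close> has come to \<open>v\<close> and has visited \<open>A 0, \<dots>, A i\<close> in this order; one step either
  follows an edge or, at a vertex of the next set, moves one copy up. The argument \<open>j\<close> bounds the
  number of steps.
\<close>

fun collected :: "'a rel \<Rightarrow> 'a set \<Rightarrow> (nat \<Rightarrow> 'a set) \<Rightarrow> nat \<Rightarrow> nat \<Rightarrow> ('a \<times> nat) set" where
  "collected E B A k 0 = (B \<inter> A 0) \<times> {0}"
| "collected E B A k (Suc j) = collected E B A k j
     \<union> {(v, i). v \<in> B \<and> (\<exists>u. (u, i) \<in> collected E B A k j \<and> (u, v) \<in> E)}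
     \<union> {(v, Suc i) | v i. (v, i) \<in> collected E B A k j \<and> v \<in> A (Suc i) \<and> Suc i < k}"

lemma collected_subset: "k \<ge> 1 \<Longrightarrow> collected E B A k j \<subseteq> B \<times> {..<k}"
  by (induction j) auto

lemma collected_mono: "i \<le> j \<Longrightarrow> collected E B A k i \<subseteq> collected E B A k j"
  by (rule lift_Suc_mono_le[of "collected E B A k"]) auto

text \<open>
  The walk behind a state, as a vertex set: \<open>j\<close> steps visit at most \<open>j + 1\<close> vertices.
\<close>

lemma collected_connected_set:
  assumes "sym E" "finite B"
  shows "(v, i) \<in> collected E B A k j \<Longrightarrow>
    \<exists>T. T \<subseteq> B \<and> connected_in E T \<and> card T \<le> Suc j \<and> v \<in> T \<and> (\<forall>l\<le>i. T \<inter> A l \<noteq> {})"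
proof (induction j arbitrary: v i)
  case 0
  then show ?case
    using connected_in_singleton[OF \<open>sym E\<close>, of v] by (intro exI[of _ "{v}"]) auto
next
  case (Suc j)
  from Suc.prems consider
      "(v, i) \<in> collected E B A k j"
    | u where "v \<in> B" "(u, i) \<in> collected E B A k j" "(u, v) \<in> E"
    | i' where "i = Suc i'" "(v, i') \<in> collected E B A k j" "v \<in> A i"
    by auto
  then show ?case
  proof cases
    case 1
    then show ?thesis
      using Suc.IH by (meson le_SucI)
  next
    case 2
    then obtain T where T: "T \<subseteq> B" "connected_in E T" "card T \<le> Suc j" "u \<in> T"
        "\<forall>l\<le>i. T \<inter> A l \<noteq> {}"
      using Suc.IH by meson
    have "card (insert v T) \<le> Suc (Suc j)"
      using T(3) card_insert_le_m1[of "Suc (Suc j)" T v] by simp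
    moreover have "connected_in E (insert v T)"
      using connected_in_insert[OF \<open>sym E\<close> T(2,4) 2(3)] .
    ultimately show ?thesis
      using T 2 by (intro exI[of _ "insert v T"]) blast
  next
    case 3
    then obtain T where T: "T \<subseteq> B" "connected_in E T" "card T \<le> Suc j" "v \<in> T"
        "\<forall>l\<le>i'. T \<inter> A l \<noteq> {}"
      using Suc.IH by meson
    then have "\<forall>l\<le>i. T \<inter> A l \<noteq> {}"
      using 3 by (auto simp: le_Suc_eq)
    then show ?thesis
      using T by (intro exI[of _ T]) auto
  qed
qed

text \<open>
  If the search reaches the top copy within \<open>t - 1\<close> steps, its walk is the linking set \<open>T\<close>.
  Otherwise the first \<open>t\<close> distance layers are disjoint sets of states, all of them below the goal,
  and the smallest has at most \<open>k * card B / t\<close> states; \<open>Z\<close> is its projection to \<open>B\<close>. A connected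
  set that avoids \<open>Z\<close> and meets every \<open>A i\<close> would lead the search past this layer without entering
  it, although no step skips a layer.
\<close>

lemma linking_or_separating:
  fixes A :: "nat \<Rightarrow> 'a set"
  assumes "sym E" "finite B" "k \<ge> 1" "t \<ge> 1"
  obtains
    (linked) T where "T \<subseteq> B" "connected_in E T" "card T \<le> t" "\<And>i. i < k \<Longrightarrow> T \<inter> A i \<noteq> {}"
  | (separated) Z where "Z \<subseteq> B" "card Z * t \<le> k * card B"
      "\<And>D. D \<subseteq> B - Z \<Longrightarrow> connected_in E D \<Longrightarrow> \<exists>i<k. D \<inter> A i = {}"
proof (cases "\<exists>v. (v, k - 1) \<in> collected E B A k (t - 1)")
  case True
  then obtain T where "T \<subseteq> B" "connected_in E T" "card T \<le> Suc (t - 1)" "\<forall>l\<le>k-1. T \<inter> A l \<noteq> {}"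
    using collected_connected_set[OF assms(1,2)] by meson
  then show ?thesis
    using linked[of T] \<open>t \<ge> 1\<close> \<open>k \<ge> 1\<close> by auto
next
  case False
  define R where "R = collected E B A k"
  define L where "L j = (case j of 0 \<Rightarrow> R 0 | Suc m \<Rightarrow> R (Suc m) - R m)" for j
  have R_sub: "R j \<subseteq> B \<times> {..<k}" for j
    unfolding R_def by (rule collected_subset[OF \<open>k \<ge> 1\<close>])
  have R_mono: "i \<le> j \<Longrightarrow> R i \<subseteq> R j" for i j
    unfolding R_def by (rule collected_mono)
  have L_sub: "L j \<subseteq> R j" for j
    by (auto simp: L_def split: nat.splits)
  have fin: "finite (L j)" for j
    using finite_subset[OF order.trans[OF L_sub R_sub]] \<open>finite B\<close> by simp
  have disj: "L i \<inter> L j = {}" if "i < j" for i j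
  proof -
    obtain m where m: "j = Suc m" "i \<le> m"
      using \<open>i < j\<close> by (cases j) auto
    have "L i \<subseteq> R m"
      using L_sub R_mono[OF m(2)] by blast
    then show ?thesis
      by (auto simp: L_def m(1))
  qed
  have "(\<Sum>j<t. card (L j)) = card (\<Union>j<t. L j)"
    by (subst card_UN_disjoint) (use fin disj in \<open>auto simp: neq_iff\<close>)
  also have "\<dots> \<le> card (B \<times> {..<k})"
    using \<open>finite B\<close> L_sub R_sub by (intro card_mono) (simp, blast)
  finally have sum: "(\<Sum>j<t. card (L j)) \<le> k * card B"
    by (simp add: card_cartesian_product mult.commute)
  have "\<exists>j<t. card (L j) * t \<le> k * card B"
  proof (rule ccontr)
    assume "\<not> ?thesis"
    then have "\<And>j. j < t \<Longrightarrow> k * card B < t * card (L j)"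
      by (auto simp: not_le mult.commute)
    then have "(\<Sum>j<t. k * card B) < (\<Sum>j<t. t * card (L j))"
      using \<open>t \<ge> 1\<close> by (intro sum_strict_mono) (auto simp: lessThan_empty_iff)
    then have "t * (k * card B) < t * (\<Sum>j<t. card (L j))"
      by (simp add: sum_distrib_left)
    then show False
      using sum by simp
  qed
  then obtain j where j: "j < t" "card (L j) * t \<le> k * card B"
    by blast
  define Z where "Z = fst ` L j"
  show ?thesis
  proof (rule separated[of Z])
    show "Z \<subseteq> B"
      using L_sub R_sub unfolding Z_def by fastforce
    show "card Z * t \<le> k * card B"
      using j(2) card_image_le[OF fin, of fst j] unfolding Z_def
      by (meson le_trans mult_le_mono1)
  next
    fix D assume D: "D \<subseteq> B - Z" "connected_in E D"
    show "\<exists>i<k. D \<inter> A i = {}"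
    proof (rule ccontr)
      assume "\<not> ?thesis"
      then have meets: "D \<inter> A i \<noteq> {}" if "i < k" for i
        using that by blast
      have notL: "(v, i) \<notin> L j" if "v \<in> D" for v i
        using that D(1) unfolding Z_def by force
      obtain a where a: "a \<in> D" "a \<in> A 0"
        using meets[of 0] \<open>k \<ge> 1\<close> by auto
      have aR: "(a, 0) \<in> R 0"
        using a D(1) by (auto simp: R_def)
      obtain m where m: "j = Suc m"
        using aR notL[OF a(1), of 0] by (cases j) (auto simp: L_def)
      have earlier: "(v, i) \<in> R m" if "v \<in> D" "(v, i) \<in> R (Suc m)" for v i
        using notL[OF that(1), of i] that(2) by (auto simp: L_def m)
      \<comment> \<open>No state over \<open>D\<close> lies in layer \<open>j = m + 1\<close>, so a search confined to \<open>D\<close> never leaves \<open>R m\<close>,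
        and all copies of \<open>D\<close> are swept inside \<open>R m\<close>.\<close>
      have "\<forall>v\<in>D. (v, i) \<in> R m" if "i < k" for i
        using that
      proof (induction i)
        case 0
        show ?case
        proof
          fix v assume "v \<in> D"
          with D(2) show "(v, 0) \<in> R m"
            using a(1) 
          proof (rule connected_in_induct)
            show "(a, 0) \<in> R m"
              using aR R_mono[of 0 m] by auto
            show "(w, 0) \<in> R m" if "u \<in> D" "w \<in> D" "(u, w) \<in> E" "(u, 0) \<in> R m" for u w
              using that D(1) by (intro earlier) (auto simp: R_def)
          qed
        qed
      next
        case (Suc i)
        obtain b where b: "b \<in> D" "b \<in> A (Suc i)"
          using meets[OF Suc.prems] by auto
        show ?case
        proof
          fix v assume "v \<in> D"
          with D(2) show "(v, Suc i) \<in> R m"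
            using b(1)
          proof (rule connected_in_induct)
            show "(b, Suc i) \<in> R m"
              using Suc b by (intro earlier) (auto simp: R_def)
            show "(w, Suc i) \<in> R m" if "u \<in> D" "w \<in> D" "(u, w) \<in> E" "(u, Suc i) \<in> R m" for u w
              using that D(1) by (intro earlier) (auto simp: R_def)
          qed
        qed
      qed
      then have "(a, k - 1) \<in> R m"
        using a(1) \<open>k \<ge> 1\<close> by auto
      moreover have "m \<le> t - 1"
        using j(1) m by simp
      ultimately show False
        using False R_mono[of m "t - 1"] unfolding R_def by blast
    qed
  qed
qed

section \<open>Pairwise intersecting families of connected sets\<close>

text \<open>
  The branch sets of a complete minor: contracting each of them yields a clique.
\<close>

definition clique_model :: "'a rel \<Rightarrow> 'a set set \<Rightarrow> bool" where
  "clique_model E \<C> \<longleftrightarrow> (\<forall>C\<in>\<C>. connected_in E C) \<and> pairwise disjnt \<C> \<and>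
     pairwise (\<lambda>C D. \<exists>u\<in>C. \<exists>v\<in>D. (u, v) \<in> E) \<C>"

lemma clique_model_insert:
  assumes "sym E" "clique_model E \<C>" "connected_in E T" "T \<inter> \<Union>\<C> = {}"
    "\<And>C. C \<in> \<C> \<Longrightarrow> \<exists>u\<in>C. \<exists>v\<in>T. (u, v) \<in> E"
  shows "clique_model E (insert T \<C>)"
  using assms(2-) symD[OF \<open>sym E\<close>] unfolding clique_model_def pairwise_insert disjnt_def
  by (auto; blast)

lemma clique_model_subset: "clique_model E \<C> \<Longrightarrow> \<D> \<subseteq> \<C> \<Longrightarrow> clique_model E \<D>"
  unfolding clique_model_def by (meson pairwise_subset subsetD)

text \<open>
  The state of the construction consists of branch sets \<open>\<C>\<close>, a set \<open>X\<close> of at most \<open>t\<close> vertices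
  from each of them, and a part \<open>B\<close> of the graph that contains a member of \<open>\<F>\<close> and that only \<open>X\<close>
  separates from the rest. The branch sets themselves may be large; it is only \<open>X\<close> that has to be
  small, so that some member of \<open>\<F>\<close> avoids it. As this member meets the one inside \<open>B\<close> and
  cannot cross \<open>X\<close>, it lies in \<open>B\<close> as well.

  A branch set without neighbours in \<open>B\<close> is discarded. If all have neighbours there, then
  \<open>linking_or_separating\<close> is applied to their neighbourhoods in \<open>B\<close>. A linking set becomes a new
  branch set and moves entirely from \<open>B\<close> to \<open>X\<close>. Given a separator \<open>Z\<close>, the component \<open>D\<close> of
  \<open>B - Z\<close> that holds a member of \<open>\<F>\<close> misses the neighbourhood of some \<open>C\<close>. Then \<open>C\<close> expands into
  \<open>B - D\<close> as far as possible, and the part of \<open>Z\<close> that it swallows replaces \<open>X \<inter> C\<close>.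
\<close>

lemma bramble_growth:
  assumes "sym E" "finite V" "t \<ge> 1" and size: "h * card V \<le> t * t"
    and conn: "\<And>F. F \<in> \<F> \<Longrightarrow> connected_in E F"
    and meet: "\<And>F F'. F \<in> \<F> \<Longrightarrow> F' \<in> \<F> \<Longrightarrow> F \<inter> F' \<noteq> {}"
    and unhit: "\<And>X. X \<subseteq> V \<Longrightarrow> card X \<le> h * t \<Longrightarrow> \<exists>F\<in>\<F>. F \<inter> X = {}"
  shows "clique_model E \<C> \<Longrightarrow> \<Union>\<C> \<subseteq> V \<Longrightarrow> finite \<C> \<Longrightarrow> card \<C> \<le> h \<Longrightarrow> X \<subseteq> \<Union>\<C> \<Longrightarrow>
    (\<forall>C\<in>\<C>. card (X \<inter> C) \<le> t) \<Longrightarrow> B \<subseteq> V \<Longrightarrow> B \<inter> \<Union>\<C> = {} \<Longrightarrow> E `` B \<subseteq> B \<union> X \<Longrightarrow>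
    \<exists>F\<in>\<F>. F \<subseteq> B \<Longrightarrow>
    \<exists>\<D>. clique_model E \<D> \<and> \<Union>\<D> \<subseteq> V \<and> card \<D> = h"
proof (induction "card B * (h + 1) + card \<C>" arbitrary: \<C> X B rule: less_induct)
  case less
  note model = less.prems(1) and CV = less.prems(2) and finC = less.prems(3)
    and Xsub = less.prems(5) and Xt = less.prems(6) and BV = less.prems(7)
    and BC = less.prems(8) and EB = less.prems(9)
  obtain F where F: "F \<in> \<F>" "F \<subseteq> B"
    using less.prems(10) by blast
  have finB: "finite B" and finX: "finite X"
    using BV order.trans[OF Xsub CV] \<open>finite V\<close> by (auto intro: finite_subset)
  \<comment> \<open>The measure is lexicographic: as \<open>card \<C> \<le> h\<close>, one vertex of \<open>B\<close> outweighs all branch sets.\<close>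
  have shrink: "card B' * (h + 1) + c < card B * (h + 1) + card \<C>"
    if "B' \<subset> B" "c \<le> h" for B' c
  proof -
    have "card B' + 1 \<le> card B"
      using psubset_card_mono[OF finB that(1)] by simp
    then have "(card B' + 1) * (h + 1) \<le> card B * (h + 1)"
      by (rule mult_le_mono1)
    then show ?thesis
      using that(2) by (simp add: algebra_simps)
  qed
  have cardX: "card X \<le> card \<C> * t"
  proof -
    have "X = (\<Union>C\<in>\<C>. X \<inter> C)"
      using Xsub by blast
    then have "card X \<le> (\<Sum>C\<in>\<C>. card (X \<inter> C))"
      using card_UN_le[OF finC, of "\<lambda>C. X \<inter> C"] by simp
    also have "\<dots> \<le> (\<Sum>C\<in>\<C>. t)"
      using Xt by (intro sum_mono) auto
    finally show ?thesis
      by simp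
  qed
  have inB: "F' \<subseteq> B" if F': "F' \<in> \<F>" "F' \<inter> X = {}" for F'
  proof
    fix v assume "v \<in> F'"
    obtain r where "r \<in> F'" "r \<in> B"
      using meet[OF F(1) F'(1)] F(2) by blast
    from conn[OF F'(1)] \<open>v \<in> F'\<close> this show "v \<in> B"
      by (rule connected_in_induct) (use EB F'(2) in blast)
  qed
  define A where "A C = B \<inter> E `` C" for C
  show ?case
  proof (cases "card \<C> = h")
    case True
    then show ?thesis
      using model CV by blast
  next
    case False
    then have less_h: "card \<C> < h"
      using less.prems(4) by simp
    then have budget: "card X + t \<le> h * t"
      using cardX mult_le_mono1[of "Suc (card \<C>)" h t] by simp
    show ?thesis
    proof (cases "\<exists>C\<in>\<C>. A C = {}")
      case True
      then obtain C where C: "C \<in> \<C>" "A C = {}"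
        by blast
      have eq: "card (\<C> - {C}) < card \<C>"
        using C finC by (meson card_Diff1_less)
      show ?thesis
      proof (rule less.hyps[of B "\<C> - {C}" "X - C"])
        show "card B * (h + 1) + card (\<C> - {C}) < card B * (h + 1) + card \<C>"
          using eq by simp
        show "clique_model E (\<C> - {C})"
          using clique_model_subset[OF model] by blast
        show "E `` B \<subseteq> B \<union> (X - C)"
        proof
          fix v assume v: "v \<in> E `` B"
          then have "v \<notin> C"
            using C(2) symD[OF \<open>sym E\<close>] unfolding A_def by blast
          then show "v \<in> B \<union> (X - C)"
            using v EB by blast
        qed
        show "\<forall>D\<in>\<C> - {C}. card ((X - C) \<inter> D) \<le> t"
        proof
          fix D assume "D \<in> \<C> - {C}"
          then have "card ((X - C) \<inter> D) \<le> card (X \<inter> D)"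
            using finX by (intro card_mono) auto
          then show "card ((X - C) \<inter> D) \<le> t"
            using Xt \<open>D \<in> \<C> - {C}\<close> by fastforce
        qed
        show "X - C \<subseteq> \<Union>(\<C> - {C})" "B \<inter> \<Union>(\<C> - {C}) = {}" "\<Union>(\<C> - {C}) \<subseteq> V"
          using Xsub BC CV by blast+
      qed (use less_h eq finC BV F in auto)
    next
      case nonempty: False
      have extend: ?thesis
        if T: "T \<subseteq> B" "connected_in E T" "card T \<le> t" "\<And>C. C \<in> \<C> \<Longrightarrow> T \<inter> A C \<noteq> {}" for T
      proof -
        have "card (X \<union> T) \<le> h * t"
          using card_Un_le[of X T] T(3) budget by simp
        then obtain F' where F': "F' \<in> \<F>" "F' \<inter> (X \<union> T) = {}"
          using unhit[of "X \<union> T"] Xsub CV T(1) BV by blast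
        have "T \<noteq> {}"
          using connected_in_nonempty[OF T(2)] .
        have notin: "T \<notin> \<C>"
          using \<open>T \<noteq> {}\<close> T(1) BC by blast
        show ?thesis
        proof (rule less.hyps[of "B - T" "insert T \<C>" "X \<union> T"])
          show "card (B - T) * (h + 1) + card (insert T \<C>) < card B * (h + 1) + card \<C>"
            using shrink[of "B - T" "card (insert T \<C>)"] \<open>T \<noteq> {}\<close> T(1) notin finC less_h
            by auto
          show "clique_model E (insert T \<C>)"
          proof (rule clique_model_insert[OF \<open>sym E\<close> model T(2)])
            show "\<exists>u\<in>C. \<exists>v\<in>T. (u, v) \<in> E" if "C \<in> \<C>" for C
              using T(4)[OF that] unfolding A_def by blast
          qed (use T(1) BC in blast)
          show "\<forall>C\<in>insert T \<C>. card ((X \<union> T) \<inter> C) \<le> t"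
          proof
            fix C assume "C \<in> insert T \<C>"
            moreover have "(X \<union> T) \<inter> T = T"
              by blast
            moreover have "(X \<union> T) \<inter> C = X \<inter> C" if "C \<in> \<C>"
              using that T(1) BC by blast
            ultimately show "card ((X \<union> T) \<inter> C) \<le> t"
              using Xt T(3) by auto
          qed
          show "E `` (B - T) \<subseteq> (B - T) \<union> (X \<union> T)"
            using EB by blast
          show "\<exists>F\<in>\<F>. F \<subseteq> B - T"
            using F' inB[of F'] by blast
          show "\<Union>(insert T \<C>) \<subseteq> V"
            using CV T(1) BV by auto
          show "X \<union> T \<subseteq> \<Union>(insert T \<C>)"
            using Xsub by auto
          show "(B - T) \<inter> \<Union>(insert T \<C>) = {}"
            using BC by auto
          show "B - T \<subseteq> V"
            using BV by auto
        qed (use finC less_h notin in auto)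
      qed
      show ?thesis
      proof (cases "\<C> = {}")
        case True
        obtain v where "v \<in> B"
          using F connected_in_nonempty[OF conn[OF F(1)]] by blast
        then show ?thesis
          using extend[of "{v}"] connected_in_singleton[OF \<open>sym E\<close>, of v] True \<open>t \<ge> 1\<close> by auto
      next
        case False
        obtain cs where cs: "set cs = \<C>" "distinct cs"
          using finite_distinct_list[OF finC] by blast
        have len: "length cs = card \<C>" "length cs \<ge> 1"
          using cs False distinct_card[of cs] by (auto simp: Suc_le_eq)
        show ?thesis
        proof (rule linking_or_separating[OF \<open>sym E\<close> finB len(2) \<open>t \<ge> 1\<close>, of "\<lambda>i. A (cs ! i)"])
          fix T assume T: "T \<subseteq> B" "connected_in E T" "card T \<le> t"
            "\<And>i. i < length cs \<Longrightarrow> T \<inter> A (cs ! i) \<noteq> {}"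
          then show ?thesis
            using extend[of T] cs(1) by (metis in_set_conv_nth)
        next
          fix Z assume Z: "Z \<subseteq> B" "card Z * t \<le> length cs * card B"
            "\<And>D. D \<subseteq> B - Z \<Longrightarrow> connected_in E D \<Longrightarrow> \<exists>i<length cs. D \<inter> A (cs ! i) = {}"
          have finZ: "finite Z"
            using Z(1) finB by (rule finite_subset)
          have "length cs * card B \<le> h * card V"
            using less_h len(1) BV \<open>finite V\<close> by (intro mult_le_mono) (auto intro: card_mono)
          then have "card Z * t \<le> t * t"
            using Z(2) size by linarith
          \<comment> \<open>This is where the hypothesis \<open>h * card V \<le> t * t\<close> enters.\<close>
          then have cardZ: "card Z \<le> t"
            using \<open>t \<ge> 1\<close> by simp
          then have "card (X \<union> Z) \<le> h * t"
            using card_Un_le[of X Z] budget by simp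
          then obtain F' where F': "F' \<in> \<F>" "F' \<inter> (X \<union> Z) = {}"
            using unhit[of "X \<union> Z"] Xsub CV Z(1) BV by blast
          have "F' \<subseteq> B - Z"
            using F' inB[of F'] by blast
          then obtain D where D: "F' \<subseteq> D" "D \<subseteq> B - Z" "connected_in E D" "E `` D \<inter> (B - Z) \<subseteq> D"
            using connected_in_component[OF \<open>sym E\<close> conn[OF F'(1)]] by metis
          obtain C where C: "C \<in> \<C>" "D \<inter> A C = {}"
            using Z(3)[OF D(2,3)] cs(1) by (metis nth_mem)
          have connC: "connected_in E C"
            using model C(1) by (simp add: clique_model_def)
          obtain C' where C': "C \<subseteq> C'" "C' \<subseteq> (B - D) \<union> C" "connected_in E C'"
            "E `` C' \<inter> ((B - D) \<union> C) \<subseteq> C'"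
            using connected_in_component[OF \<open>sym E\<close> connC, of "(B - D) \<union> C"] by blast
          have disjC: "C \<inter> C2 = {}" if "C2 \<in> \<C> - {C}" for C2
            using model C(1) that by (auto simp: clique_model_def pairwise_def disjnt_def)
          have C'disj: "C' \<inter> C2 = {}" if "C2 \<in> \<C> - {C}" for C2
            using disjC[OF that] C'(2) BC that by blast
          have "C' \<noteq> {}"
            using connected_in_nonempty[OF C'(3)] .
          have notin: "C' \<notin> \<C> - {C}"
            using C'disj[of C'] \<open>C' \<noteq> {}\<close> by blast
          have cardC': "card (insert C' (\<C> - {C})) = card \<C>"
            using card.remove[OF finC C(1)] card_insert_disjoint[OF _ notin] finite_Diff[OF finC]
            by metis
          obtain a where a: "a \<in> A C"
            using nonempty C(1) by blast
          have "a \<in> C'" "a \<in> B"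
            using a C(2) C'(1,4) unfolding A_def by auto
          define X' where "X' = (X - C) \<union> (Z \<inter> C')"
          show ?thesis
          proof (rule less.hyps[of "B - C'" "insert C' (\<C> - {C})" X'])
            show "card (B - C') * (h + 1) + card (insert C' (\<C> - {C}))
                < card B * (h + 1) + card \<C>"
              unfolding cardC' using \<open>a \<in> C'\<close> \<open>a \<in> B\<close> less_h by (intro shrink) auto
            show "clique_model E (insert C' (\<C> - {C}))"
            proof (rule clique_model_insert[OF \<open>sym E\<close> _ C'(3)])
              show "clique_model E (\<C> - {C})"
                using clique_model_subset[OF model] by blast
              show "\<exists>u\<in>C2. \<exists>v\<in>C'. (u, v) \<in> E" if "C2 \<in> \<C> - {C}" for C2
              proof -
                have "\<exists>u\<in>C2. \<exists>v\<in>C. (u, v) \<in> E"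
                  using model that C(1) by (auto simp: clique_model_def pairwise_def)
                then show ?thesis
                  using C'(1) by blast
              qed
            qed (use C'disj in blast)
            show "\<forall>C2\<in>insert C' (\<C> - {C}). card (X' \<inter> C2) \<le> t"
            proof
              fix C2 assume C2: "C2 \<in> insert C' (\<C> - {C})"
              show "card (X' \<inter> C2) \<le> t"
              proof (cases "C2 = C'")
                case True
                have "X' \<inter> C' \<subseteq> Z"
                  using Xsub C'(2) BC unfolding X'_def by blast
                then show ?thesis
                  unfolding True using cardZ card_mono[OF finZ] by (meson le_trans)
              next
                case False
                then have "C2 \<in> \<C> - {C}"
                  using C2 by blast
                then have "X' \<inter> C2 \<subseteq> X \<inter> C2"
                  using C'disj[of C2] unfolding X'_def by blast
                then have "card (X' \<inter> C2) \<le> card (X \<inter> C2)"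
                  using finX by (intro card_mono) auto
                then show ?thesis
                  using Xt \<open>C2 \<in> \<C> - {C}\<close> by fastforce
              qed
            qed
            show "X' \<subseteq> \<Union>(insert C' (\<C> - {C}))"
              using Xsub unfolding X'_def by blast
            show "(B - C') \<inter> \<Union>(insert C' (\<C> - {C})) = {}" "B - C' \<subseteq> V"
              using BC BV by blast+
            show "\<Union>(insert C' (\<C> - {C})) \<subseteq> V"
              using C'(2) BV CV C(1) by blast
            show "E `` (B - C') \<subseteq> (B - C') \<union> X'"
            proof
              fix v assume "v \<in> E `` (B - C')"
              then obtain u where u: "u \<in> B" "u \<notin> C'" "(u, v) \<in> E"
                by blast
              have vu: "(v, u) \<in> E"
                using u(3) symD[OF \<open>sym E\<close>] by blast
              \<comment> \<open>The edge does not end in \<open>C\<close>, because \<open>D\<close> misses the neighbourhood of \<open>C\<close> and \<open>C'\<close> has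
                swallowed the neighbours outside \<open>D\<close>. If it ends in \<open>C'\<close>, then it comes from \<open>D\<close>, since the rest
                of \<open>B - C'\<close> has no neighbours in \<open>C'\<close>; and \<open>D\<close> can only be left through \<open>Z\<close>.\<close>
              have "v \<notin> C"
              proof
                assume "v \<in> C"
                then have "u \<in> A C"
                  using u vu unfolding A_def by blast
                then show False
                  using C(2) C'(1,4) u vu \<open>v \<in> C\<close> by blast
              qed
              moreover have "v \<in> Z" if "v \<in> C'"
              proof -
                have v: "v \<in> B - D"
                  using that C'(2) \<open>v \<notin> C\<close> by blast
                have "u \<in> D"
                  using C'(4) that vu u by blast
                then show "v \<in> Z"
                  using D(4) v u(3) by blast
              qed
              ultimately show "v \<in> (B - C') \<union> X'"
                using EB u unfolding X'_def by blast
            qed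
            have "F' \<subseteq> B - C'"
              using D(1,2) C'(2) BC C(1) by blast
            then show "\<exists>F\<in>\<F>. F \<subseteq> B - C'"
              using F'(1) by blast
          qed (use cardC' less_h finC in auto)
        qed
      qed
    qed
  qed
qed

text \<open>
  The construction starts without branch sets and with the whole graph as \<open>B\<close>. While no hitting
  set of size \<open>h * t\<close> exists, it does not stop before \<open>h\<close> branch sets are found.
\<close>

theorem bramble_hitting_set_or_clique_model:
  assumes "sym E" "E \<subseteq> V \<times> V" "finite V" "h * card V \<le> t * t"
    and "\<And>F. F \<in> \<F> \<Longrightarrow> connected_in E F \<and> F \<subseteq> V"
    and "\<And>F F'. F \<in> \<F> \<Longrightarrow> F' \<in> \<F> \<Longrightarrow> F \<inter> F' \<noteq> {}"
  obtains (hit) X where "X \<subseteq> V" "card X \<le> h * t" "\<And>F. F \<in> \<F> \<Longrightarrow> F \<inter> X \<noteq> {}"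
  | (model) \<C> where "clique_model E \<C>" "\<Union>\<C> \<subseteq> V" "card \<C> = h"
proof (cases "\<exists>X\<subseteq>V. card X \<le> h * t \<and> (\<forall>F\<in>\<F>. F \<inter> X \<noteq> {})")
  case True
  then show ?thesis
    using hit by blast
next
  case False
  then have unhit: "\<exists>F\<in>\<F>. F \<inter> X = {}" if "X \<subseteq> V" "card X \<le> h * t" for X
    using that by blast
  show ?thesis
  proof (cases "h = 0")
    case True
    then show ?thesis
      using model[of "{}"] by (simp add: clique_model_def)
  next
    case False
    obtain F where F: "F \<in> \<F>"
      using unhit[of "{}"] by auto
    have "F \<noteq> {}" "F \<subseteq> V"
      using assms(5)[OF F] by (auto simp: connected_in_def)
    then have "card V > 0"
      using \<open>finite V\<close> by (auto simp: card_gt_0_iff)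
    then have "t \<ge> 1"
      using assms(4) False by (cases t) auto
    have "\<exists>\<C>. clique_model E \<C> \<and> \<Union>\<C> \<subseteq> V \<and> card \<C> = h"
    proof (rule bramble_growth[where \<F> = \<F> and \<C> = "{}" and X = "{}" and B = V])
      show "clique_model E {}"
        by (simp add: clique_model_def)
    qed (use assms \<open>t \<ge> 1\<close> unhit F \<open>F \<subseteq> V\<close> in \<open>auto\<close>)
    then show ?thesis
      using model by blast
  qed
qed

section \<open>Longest paths meet\<close>

definition path_in :: "'a rel \<Rightarrow> 'a list \<Rightarrow> bool" where
  "path_in E xs \<longleftrightarrow> xs \<noteq> [] \<and> distinct xs \<and> successively (\<lambda>x y. (x, y) \<in> E) xs"

lemma path_in_append:
  assumes "path_in E xs" "path_in E ys" "set xs \<inter> set ys = {}" "(last xs, hd ys) \<in> E"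
  shows "path_in E (xs @ ys)"
  using assms by (simp add: path_in_def successively_append_iff)

lemma path_in_prefix: "path_in E (xs @ ys) \<Longrightarrow> xs \<noteq> [] \<Longrightarrow> path_in E xs"
  by (simp add: path_in_def successively_append_iff)

lemma path_in_suffix: "path_in E (xs @ ys) \<Longrightarrow> ys \<noteq> [] \<Longrightarrow> path_in E ys"
  by (simp add: path_in_def successively_append_iff)

lemma path_in_rev:
  assumes "sym E"
  shows "path_in E (rev xs) \<longleftrightarrow> path_in E xs"
proof -
  have "(\<lambda>x y. (y, x) \<in> E) = (\<lambda>x y. (x, y) \<in> E)"
    using symD[OF assms] by blast
  then have "successively (\<lambda>x y. (x, y) \<in> E) (rev xs) = successively (\<lambda>x y. (x, y) \<in> E) xs"
    unfolding successively_rev by (rule arg_cong)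
  then show ?thesis
    unfolding path_in_def by simp
qed

lemma connected_in_path:
  assumes "connected_in E D" "u \<in> D" "v \<in> D"
  obtains xs where "path_in E xs" "set xs \<subseteq> D" "hd xs = u" "last xs = v"
proof -
  have "\<exists>xs. path_in E xs \<and> set xs \<subseteq> D \<and> hd xs = u \<and> last xs = v"
    using assms(1,3,2)
  proof (rule connected_in_induct)
    show "\<exists>xs. path_in E xs \<and> set xs \<subseteq> D \<and> hd xs = u \<and> last xs = u"
      using \<open>u \<in> D\<close> by (intro exI[of _ "[u]"]) (simp add: path_in_def)
  next
    fix w z assume wz: "w \<in> D" "z \<in> D" "(w, z) \<in> E"
      and "\<exists>xs. path_in E xs \<and> set xs \<subseteq> D \<and> hd xs = u \<and> last xs = w"
    then obtain xs where xs: "path_in E xs" "set xs \<subseteq> D" "hd xs = u" "last xs = w"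
      by blast
    have ne: "xs \<noteq> []"
      using xs(1) by (simp add: path_in_def)
    show "\<exists>xs. path_in E xs \<and> set xs \<subseteq> D \<and> hd xs = u \<and> last xs = z"
    proof (cases "z \<in> set xs")
      case True
      then obtain ys zs where split: "xs = (ys @ [z]) @ zs"
        by (metis split_list append.assoc append_Cons append_Nil)
      have "path_in E (ys @ [z])"
        using xs(1) unfolding split by (rule path_in_prefix) simp
      moreover have "hd (ys @ [z]) = u"
        using xs(3) split by (cases ys) auto
      ultimately show ?thesis
        using xs(2) split by (intro exI[of _ "ys @ [z]"]) auto
    next
      case False
      have "path_in E (xs @ [z])"
        using xs False wz by (intro path_in_append) (auto simp: path_in_def)
      then show ?thesis
        using xs wz ne by (intro exI[of _ "xs @ [z]"]) auto
    qed
  qed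
  then show ?thesis
    using that by blast
qed

lemma connected_in_path_set:
  assumes "sym E" "path_in E p"
  shows "connected_in E (set p)"
  using assms(2)
proof (induction p rule: rev_induct)
  case (snoc x p)
  show ?case
  proof (cases "p = []")
    case True
    then show ?thesis
      using connected_in_singleton[OF assms(1), of x] by simp
  next
    case False
    then have "path_in E p" "(last p, x) \<in> E"
      using snoc.prems by (auto simp: path_in_def successively_append_iff)
    then have "connected_in E (insert x (set p))"
      using connected_in_insert[OF assms(1) snoc.IH, of "last p" x] False by simp
    then show ?thesis
      by simp
  qed
qed (simp add: path_in_def)

text \<open>
  One of the two segments into which \<open>x\<close> divides \<open>p\<close>, both taken to include \<open>x\<close>, has more than
  half of the length of \<open>p\<close>.
\<close>

lemma half_path_to:
  assumes "sym E" "path_in E p" "x \<in> set p"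
  obtains p' where "path_in E p'" "set p' \<subseteq> set p" "last p' = x" "length p < 2 * length p'"
proof -
  obtain ys zs where split: "p = ys @ x # zs"
    using split_list[OF assms(3)] by blast
  have "path_in E (ys @ [x])"
    using assms(2) path_in_prefix[of E "ys @ [x]" zs] by (simp add: split)
  moreover have "path_in E (rev (x # zs))"
    unfolding path_in_rev[OF assms(1)] using assms(2) path_in_suffix[of E ys "x # zs"]
    by (simp add: split)
  ultimately show ?thesis
    using that[of "ys @ [x]"] that[of "rev (x # zs)"]
    by (cases "length zs \<le> length ys") (auto simp: split)
qed

text \<open>
  A shortest path from \<open>P\<close> to \<open>Q\<close> has no inner vertices in either set.
\<close>

lemma connecting_path:
  assumes "connected_in E V" "P \<subseteq> V" "Q \<subseteq> V" "P \<noteq> {}" "Q \<noteq> {}" "P \<inter> Q = {}"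
  obtains x s y where "x \<in> P" "y \<in> Q" "path_in E (x # s @ [y])" "set s \<subseteq> V" "set s \<inter> (P \<union> Q) = {}"
proof -
  let ?ok = "\<lambda>r. path_in E r \<and> set r \<subseteq> V \<and> hd r \<in> P \<and> last r \<in> Q"
  obtain u v where "u \<in> P" "v \<in> Q"
    using assms by blast
  then obtain r0 where "?ok r0"
    using connected_in_path[OF assms(1), of u v] assms(2,3) by (metis subsetD)
  then obtain r where r: "?ok r" "\<And>r'. ?ok r' \<Longrightarrow> length r \<le> length r'"
    using ex_has_least_nat[of ?ok r0 length] by blast
  have "r \<noteq> []" "hd r \<noteq> last r"
    using r(1) assms(6) by (auto simp: path_in_def)
  then obtain x s y where xsy: "r = x # s @ [y]"
    by (metis append_butlast_last_id last_ConsL last_ConsR list.collapse list.sel(1))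
  have "z \<notin> P" if z: "z \<in> set s" for z
  proof
    assume "z \<in> P"
    obtain s1 s2 where s: "s = s1 @ z # s2"
      using split_list[OF z] by blast
    have "path_in E (z # s2 @ [y])"
      using r(1) path_in_suffix[of E "x # s1" "z # s2 @ [y]"] by (simp add: xsy s)
    then have "?ok (z # s2 @ [y])"
      using r(1) \<open>z \<in> P\<close> by (auto simp: xsy s)
    then show False
      using r(2)[of "z # s2 @ [y]"] by (simp add: xsy s)
  qed
  moreover have "z \<notin> Q" if z: "z \<in> set s" for z
  proof
    assume "z \<in> Q"
    obtain s1 s2 where s: "s = s1 @ z # s2"
      using split_list[OF z] by blast
    have "path_in E (x # s1 @ [z])"
      using r(1) path_in_prefix[of E "x # s1 @ [z]" "s2 @ [y]"] by (simp add: xsy s)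
    then have "?ok (x # s1 @ [z])"
      using r(1) \<open>z \<in> Q\<close> by (auto simp: xsy s)
    then show False
      using r(2)[of "x # s1 @ [z]"] by (simp add: xsy s)
  qed
  ultimately show ?thesis
    using that[of x y s] r(1) by (auto simp: xsy)
qed

text \<open>
  If they were disjoint, the longer half of \<open>p\<close> up to a connecting path, that path, and the longer
  half of \<open>q\<close> would form a path with more vertices than \<open>p\<close> and \<open>q\<close>, which are equally long.
\<close>

lemma longest_paths_meet:
  assumes "sym E" "connected_in E V"
    and p: "path_in E p" "set p \<subseteq> V" and q: "path_in E q" "set q \<subseteq> V"
    and longest: "\<And>r. path_in E r \<Longrightarrow> set r \<subseteq> V \<Longrightarrow> length r \<le> length p"
      "\<And>r. path_in E r \<Longrightarrow> set r \<subseteq> V \<Longrightarrow> length r \<le> length q"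
  shows "set p \<inter> set q \<noteq> {}"
proof
  assume disj: "set p \<inter> set q = {}"
  have "set p \<noteq> {}" "set q \<noteq> {}"
    using p q by (auto simp: path_in_def)
  then obtain x s y where xsy: "x \<in> set p" "y \<in> set q" "path_in E (x # s @ [y])"
      "set s \<subseteq> V" "set s \<inter> (set p \<union> set q) = {}"
    using connecting_path[OF assms(2) p(2) q(2)] disj by metis
  obtain p' where p': "path_in E p'" "set p' \<subseteq> set p" "last p' = x" "length p < 2 * length p'"
    using half_path_to[OF assms(1) p(1) xsy(1)] .
  obtain q' where q': "path_in E q'" "set q' \<subseteq> set q" "last q' = y" "length q < 2 * length q'"
    using half_path_to[OF assms(1) q(1) xsy(2)] .
  have q'rev: "path_in E (rev q')" "hd (rev q') = y" "q' \<noteq> []"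
    using q' path_in_rev[OF assms(1)] by (auto simp: hd_rev path_in_def)
  have "path_in E (p' @ s @ rev q')"
  proof (cases "s = []")
    case True
    then show ?thesis
      using xsy(3) p' q' q'rev disj
      by (auto intro!: path_in_append) (auto simp: path_in_def)
  next
    case False
    have "(x, hd s) \<in> E" "(last s, y) \<in> E" "path_in E s"
      using xsy(3) False by (auto simp: path_in_def successively_append_iff successively_Cons)
    then show ?thesis
      using xsy(5) p' q' q'rev disj False
      by (intro path_in_append) (auto simp: path_in_def)
  qed
  moreover have "set (p' @ s @ rev q') \<subseteq> V"
    using p' q' p q xsy(4) by auto
  ultimately have "length (p' @ s @ rev q') \<le> length p" "length (p' @ s @ rev q') \<le> length q"
    using longest by blast+
  then show False
    using p'(4) q'(4) by simp
qed

section \<open>Connections that cross a Jordan curve\<close>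

text \<open>
  \<open>S\<close> and \<open>W\<close> are the two sides of a closed curve \<open>J\<close>. Everything of \<open>Y\<close> on the side \<open>W\<close> hangs on
  \<open>J \<inter> Y\<close>, so that the part of \<open>Y\<close> on the other side can be removed without disconnecting it.
\<close>

lemma connected_Diff_side:
  fixes Y :: "'a::metric_space set"
  assumes "Topological_Spaces.connected Y" "Topological_Spaces.connected (J \<inter> Y)" "open S" "open W" "S \<inter> W = {}" "S \<union> W = - J"
  shows "Topological_Spaces.connected (Y - S)"
proof -
  have "Topological_Spaces.connected ((J \<inter> Y) \<union> (W \<inter> Y))"
  proof (rule connected_Un_clopen_in_complement[OF assms(2,1)])
    have *: "Y - J \<inter> Y = Y \<inter> (S \<union> W)"
      using assms(6) by blast
    show "openin (top_of_set (Y - J \<inter> Y)) (W \<inter> Y)"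
      unfolding * openin_open using \<open>open W\<close> by blast
    have "Y \<inter> (S \<union> W) \<inter> - S = W \<inter> Y"
      using assms(5) by blast
    then show "closedin (top_of_set (Y - J \<inter> Y)) (W \<inter> Y)"
      unfolding * closedin_closed using \<open>open S\<close> by (metis closed_Compl)
  qed blast
  moreover have "(J \<inter> Y) \<union> (W \<inter> Y) = Y - S"
    using assms(5,6) by blast
  ultimately show ?thesis
    by simp
qed

text \<open>
  The chord \<open>\<Gamma>\<close> stays out of the side \<open>S\<close> and covers the places where the two parts \<open>P\<close> and \<open>Q\<close> of
  the curve meet; \<open>\<Delta>1\<close> and \<open>\<Delta>2\<close> form a second chord, which runs from \<open>P\<close> over \<open>w\<close> to \<open>Q\<close>. From a
  point of \<open>S\<close> one reaches \<open>w\<close> without touching \<open>P \<union> \<Gamma>\<close>, by crossing the curve in \<open>Q\<close>, and likewise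
  without touching \<open>Q \<union> \<Gamma>\<close>. These two sets intersect in the connected set \<open>\<Gamma>\<close>, so by Janiszewski's
  theorem their union, which contains the curve, does not separate \<open>w\<close> from \<open>S\<close> either.
\<close>

lemma no_crossing_chords:
  fixes J :: "complex set"
  assumes "compact J" and sides: "open S" "open W" "S \<inter> W = {}" "S \<union> W = - J"
    and S: "Topological_Spaces.connected S" "S \<noteq> {}" "J \<subseteq> closure S"
    and chord: "compact \<Gamma>" "Topological_Spaces.connected \<Gamma>" "\<Gamma> \<inter> S = {}"
    and J: "closed P" "closed Q" "J = P \<union> Q" "P \<inter> Q \<subseteq> \<Gamma>"
    and w: "w \<in> W" "w \<in> \<Delta>1" "w \<in> \<Delta>2"
    and \<Delta>1: "Topological_Spaces.connected \<Delta>1" "\<Delta>1 \<inter> J \<noteq> {}" "\<Delta>1 \<inter> (Q \<union> \<Gamma>) = {}"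
    and \<Delta>2: "Topological_Spaces.connected \<Delta>2" "\<Delta>2 \<inter> J \<noteq> {}" "\<Delta>2 \<inter> (P \<union> \<Gamma>) = {}"
  shows False
proof -
  obtain z where "z \<in> S"
    using S(2) by blast
  have avoid: "connected_component (- (R \<union> \<Gamma>)) z w"
    if \<Delta>: "Topological_Spaces.connected \<Delta>" "\<Delta> \<inter> J \<noteq> {}" "\<Delta> \<inter> (R \<union> \<Gamma>) = {}" "w \<in> \<Delta>" and "R \<subseteq> J" for \<Delta> R
  proof -
    obtain x where x: "x \<in> \<Delta>" "x \<in> J"
      using \<Delta>(2) by blast
    have "Topological_Spaces.connected (insert x S)"
      using S(1) by (rule connected_intermediate_closure) (use x S(3) closure_subset in blast)+
    then have "Topological_Spaces.connected (insert x S \<union> \<Delta>)"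
      using \<Delta>(1) by (rule connected_Un) (use x in blast)
    moreover have "S \<inter> J = {}"
      using sides(4) by blast
    then have "insert x S \<union> \<Delta> \<subseteq> - (R \<union> \<Gamma>)"
      using \<Delta>(3) x(1) \<open>R \<subseteq> J\<close> chord(3) by blast
    ultimately show ?thesis
      using \<open>z \<in> S\<close> \<Delta>(4) unfolding connected_component_def by blast
  qed
  have "compact P"
    using \<open>compact J\<close> J(1,3) by (metis compact_Int_closed inf_commute inf_sup_absorb)
  have "connected_component (- ((P \<union> \<Gamma>) \<union> (Q \<union> \<Gamma>))) z w"
  proof (rule Janiszewski)
    show "compact (P \<union> \<Gamma>)"
      using \<open>compact P\<close> chord(1) by (rule compact_Un)
    show "closed (Q \<union> \<Gamma>)"
      using J(2) compact_imp_closed[OF chord(1)] by (rule closed_Un)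
    have "(P \<union> \<Gamma>) \<inter> (Q \<union> \<Gamma>) = \<Gamma>"
      using J(4) by blast
    then show "Topological_Spaces.connected ((P \<union> \<Gamma>) \<inter> (Q \<union> \<Gamma>))"
      using chord(2) by simp
    show "connected_component (- (P \<union> \<Gamma>)) z w"
      using \<Delta>2 w(3) J(3) by (intro avoid) auto
    show "connected_component (- (Q \<union> \<Gamma>)) z w"
      using \<Delta>1 w(2) J(3) by (intro avoid) auto
  qed
  then obtain A where A: "Topological_Spaces.connected A" "A \<subseteq> - ((P \<union> \<Gamma>) \<union> (Q \<union> \<Gamma>))" "z \<in> A" "w \<in> A"
    unfolding connected_component_def by blast
  have "A \<subseteq> S \<union> W"
    using A(2) sides(4) J(3) by blast
  then show False
    using connectedD[OF A(1) sides(1,2)] sides(3) A(3,4) \<open>z \<in> S\<close> w(1) by blast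
qed

text \<open>
  Here the connecting sets are given without control over which side of the curve they use. They
  are cut down to the side of \<open>X\<close> by \<open>connected_Diff_side\<close>. As \<open>X\<close> is shared by \<open>Y1\<close> and
  \<open>Y2\<close>, these two merge into one chord, and \<open>Z1\<close> and \<open>Z2\<close> give the crossing one.
\<close>

lemma no_crossing_connections:
  fixes c :: "real \<Rightarrow> complex"
  assumes c: "simple_path c" "pathfinish c = pathstart c" and J: "path_image c = P \<union> Q"
    and clo: "closed P" "closed Q" "P \<inter> Q \<subseteq> Y1 \<union> Y2"
    and Y: "compact Y1" "Topological_Spaces.connected Y1" "Topological_Spaces.connected (path_image c \<inter> Y1)"
      "compact Y2" "Topological_Spaces.connected Y2" "Topological_Spaces.connected (path_image c \<inter> Y2)"
    and Z: "Topological_Spaces.connected Z1" "Topological_Spaces.connected (path_image c \<inter> Z1)" "Z1 \<inter> path_image c \<noteq> {}"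
      "Topological_Spaces.connected Z2" "Topological_Spaces.connected (path_image c \<inter> Z2)" "Z2 \<inter> path_image c \<noteq> {}"
    and X: "Topological_Spaces.connected X" "X \<inter> path_image c = {}" "X \<inter> Y1 \<inter> Y2 \<noteq> {}" "X \<inter> Z1 \<inter> Z2 \<noteq> {}"
    and disj: "Z1 \<inter> (Q \<union> Y1 \<union> Y2) = {}" "Z2 \<inter> (P \<union> Y1 \<union> Y2) = {}"
  shows False
proof -
  let ?J = "path_image c"
  have contra: False if sides: "open S" "open W" "S \<inter> W = {}" "S \<union> W = - ?J"
    and S: "Topological_Spaces.connected S" "S \<noteq> {}" "frontier S = ?J" and "X \<subseteq> W" for S W
  proof -
    have side: "Topological_Spaces.connected (A - S)" if "Topological_Spaces.connected A" "Topological_Spaces.connected (?J \<inter> A)" for A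
      using that sides by (rule connected_Diff_side)
    obtain w where w: "w \<in> X" "w \<in> Z1" "w \<in> Z2"
      using X(4) by blast
    show False
    proof (rule no_crossing_chords[of ?J S W "(Y1 - S) \<union> (Y2 - S)" P Q w "Z1 - S" "Z2 - S"])
      show "compact ?J"
        using c(1) by (simp add: compact_path_image simple_path_imp_path)
      show "?J \<subseteq> closure S"
        unfolding S(3)[symmetric] by (simp add: frontier_def)
      show "compact ((Y1 - S) \<union> (Y2 - S))"
        using Y(1,4) sides(1) by (intro compact_Un compact_diff)
      show "Topological_Spaces.connected ((Y1 - S) \<union> (Y2 - S))"
        using X(3) \<open>X \<subseteq> W\<close> sides(3) by (intro connected_Un side Y) blast
      show "P \<inter> Q \<subseteq> (Y1 - S) \<union> (Y2 - S)"
        using clo(3) J sides(4) by blast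
      show "Topological_Spaces.connected (Z1 - S)" "Topological_Spaces.connected (Z2 - S)"
        using Z by (auto intro: side)
      show "(Z1 - S) \<inter> ?J \<noteq> {}" "(Z2 - S) \<inter> ?J \<noteq> {}"
        using Z(3,6) sides(4) by blast+
      show "w \<in> W" "w \<in> Z1 - S" "w \<in> Z2 - S"
        using w \<open>X \<subseteq> W\<close> sides(3) by blast+
    qed (use sides S clo J disj in auto)
  qed
  obtain I U where IU: "I \<noteq> {}" "open I" "Topological_Spaces.connected I" "U \<noteq> {}" "open U" "Topological_Spaces.connected U"
      "I \<inter> U = {}" "I \<union> U = - ?J" "frontier I = ?J" "frontier U = ?J"
    using Jordan_curve[OF c] by metis
  have "X \<subseteq> I \<union> U"
    using X(2) IU(8) by blast
  then have "X \<subseteq> I \<or> X \<subseteq> U"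
    using connectedD[OF X(1) IU(2,5)] IU(7) by blast
  then show False
  proof
    assume "X \<subseteq> I"
    then show False
      using contra[of U I] IU by (simp add: Int_commute Un_commute)
  next
    assume "X \<subseteq> U"
    then show False
      using contra[of I U] IU by simp
  qed
qed

section \<open>Plane drawings\<close>

fun path_edges :: "'a list \<Rightarrow> 'a set set" where
  "path_edges (x # y # xs) = insert {x, y} (path_edges (y # xs))"
| "path_edges _ = {}"

lemma path_edges_append:
  "xs \<noteq> [] \<Longrightarrow> ys \<noteq> [] \<Longrightarrow>
    path_edges (xs @ ys) = insert {last xs, hd ys} (path_edges xs \<union> path_edges ys)"
proof (induction xs rule: path_edges.induct)
  case ("2_2" v)
  then show ?case
    by (cases ys) auto
qed auto

lemma path_edges_subset: "e \<in> path_edges xs \<Longrightarrow> e \<subseteq> set xs"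
  by (induction xs rule: path_edges.induct) auto

lemma path_edges_nonempty: "e \<in> path_edges xs \<Longrightarrow> e \<noteq> {}"
  by (induction xs rule: path_edges.induct) auto

text \<open>
  With only two vertices the closing edge would be the edge of the path itself.
\<close>

lemma closing_edge_notin_path_edges:
  assumes "distinct xs" "length xs \<ge> 3"
  shows "{last xs, hd xs} \<notin> path_edges xs"
proof -
  obtain x y zs where xs: "xs = x # y # zs" "zs \<noteq> []"
    using assms(2) by (cases xs; cases "tl xs"; cases "tl (tl xs)") auto
  have "last zs \<noteq> y" "last zs \<noteq> x" "x \<notin> set (y # zs)"
    using assms(1) xs last_in_set[OF xs(2)] by auto
  then show ?thesis
    using xs path_edges_subset[of "{last zs, x}" "y # zs"] by (auto simp: doubleton_eq_iff)
qed

locale plane_graph =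
  fixes G :: "('a, 'b) pre_digraph" and pt :: "'a \<Rightarrow> complex" and crv :: "'a set \<Rightarrow> real \<Rightarrow> complex"
  assumes graph_G: "graph G" and drawing: "plane_drawing G pt crv"
begin

abbreviation "V \<equiv> verts G"
abbreviation "E \<equiv> arcs_ends G"
abbreviation "edges \<equiv> edge_sets G"

lemmas edges_def = edge_sets_def[of G]

lemma finite_V: "finite V"
  using graph_G by (simp add: graph_def digraph_def fin_digraph_def fin_digraph_axioms_def)

lemma sym_E: "sym E"
  using graph_G by (simp add: graph_def pseudo_graph_def sym_digraph_def sym_digraph_axioms_def symmetric_def)

lemma E_V: "E \<subseteq> V \<times> V"
proof -
  interpret graph G
    by (rule graph_G)
  show ?thesis
    by (auto simp: arcs_ends_def arc_to_ends_def)
qed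

lemma inj_pt: "inj_on pt V"
  using drawing by (simp add: plane_drawing_def)

text \<open>
  A subgraph is a pair of a vertex set and an edge set, so that intersections of drawings can be
  computed from intersections of subgraphs; see \<open>drawn_Int\<close>.
\<close>

definition subgraph_on :: "'a set \<Rightarrow> 'a set set \<Rightarrow> bool" where
  "subgraph_on D F \<longleftrightarrow> D \<subseteq> V \<and> F \<subseteq> edges \<and> \<Union>F \<subseteq> D"

definition drawn :: "'a set \<Rightarrow> 'a set set \<Rightarrow> complex set" where
  "drawn D F = pt ` D \<union> (\<Union>e\<in>F. path_image (crv e))"

definition induced_edges :: "'a set \<Rightarrow> 'a set set" where
  "induced_edges D = {e \<in> edges. e \<subseteq> D}"

definition region :: "'a set \<Rightarrow> complex set" where
  "region D = drawn D (induced_edges D)"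

lemma finite_edges: "finite edges"
proof -
  have "edges \<subseteq> Pow V"
    using E_V by (auto simp: edges_def)
  then show ?thesis
    using finite_V finite_subset by blast
qed

lemma edge_crv:
  assumes "e \<in> edges"
  shows "arc (crv e)" "{pathstart (crv e), pathfinish (crv e)} = pt ` e"
    "path_image (crv e) \<inter> pt ` V = pt ` e" "e \<subseteq> V" "e \<noteq> {}"
proof -
  show "arc (crv e)" "{pathstart (crv e), pathfinish (crv e)} = pt ` e"
    "path_image (crv e) \<inter> pt ` V = pt ` e"
    using drawing assms unfolding plane_drawing_def by blast+
  show "e \<subseteq> V" "e \<noteq> {}"
    using assms E_V by (auto simp: edges_def)
qed

lemma edges_cross:
  "e \<in> edges \<Longrightarrow> f \<in> edges \<Longrightarrow> e \<noteq> f \<Longrightarrow> path_image (crv e) \<inter> path_image (crv f) \<subseteq> pt ` (e \<inter> f)"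
  using drawing unfolding plane_drawing_def by blast

lemma edgeI: "(x, y) \<in> E \<Longrightarrow> {x, y} \<in> edges"
  by (auto simp: edges_def)

lemma ends_in_crv: "e \<in> edges \<Longrightarrow> pt ` e \<subseteq> path_image (crv e)"
  using edge_crv(3) by blast

lemma subgraph_on_induced_edges: "D \<subseteq> V \<Longrightarrow> subgraph_on D (induced_edges D)"
  by (auto simp: subgraph_on_def induced_edges_def)

text \<open>
  Drawings of subgraphs meet only in what the subgraphs share: curves cross at common ends only,
  and a curve passes through no vertex other than its ends. This one identity replaces all
  geometric reasoning about which curves may touch.
\<close>

lemma drawn_Int:
  assumes "subgraph_on D F" "subgraph_on D' F'"
  shows "drawn D F \<inter> drawn D' F' = drawn (D \<inter> D') (F \<inter> F')"
proof
  have inj: "pt ` A \<inter> pt ` B \<subseteq> pt ` (A \<inter> B)" if "A \<subseteq> V" "B \<subseteq> V" for A B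
    using inj_on_image_Int[OF inj_pt that] by blast
  have point_edge: "pt ` A \<inter> path_image (crv e) \<subseteq> pt ` (A \<inter> e)" if "A \<subseteq> V" "e \<in> edges" for A e
    using inj[OF that(1) edge_crv(4)[OF that(2)]] edge_crv(3)[OF that(2)] that(1) by blast
  note sub = assms[unfolded subgraph_on_def]
  show "drawn (D \<inter> D') (F \<inter> F') \<subseteq> drawn D F \<inter> drawn D' F'"
    by (auto simp: drawn_def)
  show "drawn D F \<inter> drawn D' F' \<subseteq> drawn (D \<inter> D') (F \<inter> F')"
  proof
    fix x assume x: "x \<in> drawn D F \<inter> drawn D' F'"
    then consider
        "x \<in> pt ` D" "x \<in> pt ` D'"
      | f where "x \<in> pt ` D" "f \<in> F'" "x \<in> path_image (crv f)"
      | e where "x \<in> pt ` D'" "e \<in> F" "x \<in> path_image (crv e)"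
      | e f where "e \<in> F" "f \<in> F'" "x \<in> path_image (crv e)" "x \<in> path_image (crv f)"
      by (auto simp: drawn_def)
    then show "x \<in> drawn (D \<inter> D') (F \<inter> F')"
    proof cases
      case 1
      then show ?thesis
        using inj[of D D'] sub by (auto simp: drawn_def)
    next
      case 2
      then have "x \<in> pt ` (D \<inter> f)"
        using point_edge[of D f] sub by blast
      then show ?thesis
        using 2(2) sub by (auto simp: drawn_def)
    next
      case 3
      then have "x \<in> pt ` (D' \<inter> e)"
        using point_edge[of D' e] sub by blast
      then show ?thesis
        using 3(2) sub by (auto simp: drawn_def)
    next
      case 4
      show ?thesis
      proof (cases "e = f")
        case True
        then show ?thesis
          using 4 by (auto simp: drawn_def)
      next
        case False
        then have "x \<in> pt ` (e \<inter> f)"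
          using edges_cross[of e f] 4 sub by blast
        moreover have "e \<inter> f \<subseteq> D \<inter> D'"
          using 4(1,2) sub by blast
        ultimately show ?thesis
          by (auto simp: drawn_def)
      qed
    qed
  qed
qed

lemma drawn_empty: "subgraph_on {} F \<Longrightarrow> drawn {} F = {}"
  using edge_crv(5) by (fastforce simp: subgraph_on_def drawn_def)

lemma subgraph_on_Int: "subgraph_on D F \<Longrightarrow> subgraph_on D' F' \<Longrightarrow> subgraph_on (D \<inter> D') (F \<inter> F')"
  by (auto simp: subgraph_on_def)

lemma drawn_disjoint:
  "subgraph_on D F \<Longrightarrow> subgraph_on D' F' \<Longrightarrow> D \<inter> D' = {} \<Longrightarrow> drawn D F \<inter> drawn D' F' = {}"
  using drawn_Int drawn_empty subgraph_on_Int by metis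

lemma compact_drawn:
  assumes "subgraph_on D F"
  shows "compact (drawn D F)"
  unfolding drawn_def
proof (intro compact_Un compact_UN)
  show "compact (pt ` D)"
    using assms finite_V by (auto simp: subgraph_on_def intro!: finite_imp_compact dest: finite_subset)
  show "finite F"
    using assms finite_edges by (auto simp: subgraph_on_def dest: finite_subset)
  show "compact (path_image (crv e))" if "e \<in> F" for e
    using that assms edge_crv(1) by (auto simp: subgraph_on_def intro: compact_arc_image)
qed

lemma compact_region: "D \<subseteq> V \<Longrightarrow> compact (region D)"
  unfolding region_def by (intro compact_drawn subgraph_on_induced_edges)

lemma region_disjoint: "D \<subseteq> V \<Longrightarrow> D' \<subseteq> V \<Longrightarrow> D \<inter> D' = {} \<Longrightarrow> region D \<inter> region D' = {}"
  unfolding region_def by (intro drawn_disjoint subgraph_on_induced_edges)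

lemma connected_region:
  assumes "connected_in E D" "D \<subseteq> V"
  shows "Topological_Spaces.connected (region D)"
proof -
  obtain r where r: "r \<in> D"
    using connected_in_nonempty[OF assms(1)] by blast
  let ?cc = "connected_component (region D) (pt r)"
  have along: "connected_component (region D) x y"
    if "e \<in> edges" "e \<subseteq> D" "x \<in> path_image (crv e)" "y \<in> path_image (crv e)" for e x y
  proof -
    have "path_image (crv e) \<subseteq> region D"
      using that by (auto simp: region_def drawn_def induced_edges_def)
    then show ?thesis
      unfolding connected_component_def
      using that connected_arc_image[OF edge_crv(1)[OF that(1)]] by blast
  qed
  have vertex: "?cc (pt v)" if "v \<in> D" for v
    using assms(1) that r
  proof (rule connected_in_induct)
    show "?cc (pt r)"
      using r by (simp add: region_def drawn_def)
    fix u w assume uw: "u \<in> D" "w \<in> D" "(u, w) \<in> E" "?cc (pt u)"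
    then have "{u, w} \<in> edges"
      by (auto simp: edges_def)
    then have "connected_component (region D) (pt u) (pt w)"
      using uw ends_in_crv[of "{u, w}"] by (intro along) auto
    then show "?cc (pt w)"
      using uw(4) connected_component_trans by metis
  qed
  have "?cc x" if "x \<in> region D" for x
  proof -
    from that consider v where "v \<in> D" "x = pt v"
      | e where "e \<in> edges" "e \<subseteq> D" "x \<in> path_image (crv e)"
      by (auto simp: region_def drawn_def induced_edges_def)
    then show ?thesis
    proof cases
      case 1
      then show ?thesis
        using vertex by simp
    next
      case 2
      obtain v where "v \<in> e"
        using edge_crv(5)[OF 2(1)] by blast
      then have "connected_component (region D) (pt v) x"
        using 2 ends_in_crv[OF 2(1)] by (intro along) auto
      then show ?thesis
        using vertex[of v] 2(2) \<open>v \<in> e\<close> connected_component_trans by (metis subsetD)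
    qed
  qed
  then show ?thesis
    unfolding connected_iff_connected_component
    by (meson connected_component_sym connected_component_trans)
qed

lemma path_in_edges: "path_in E xs \<Longrightarrow> path_edges xs \<subseteq> edges"
proof (induction xs rule: path_edges.induct)
  case (1 x y xs)
  then show ?case
    by (auto simp: path_in_def edges_def)
qed auto

lemma subgraph_on_path: "path_in E xs \<Longrightarrow> set xs \<subseteq> V \<Longrightarrow> subgraph_on (set xs) (path_edges xs)"
  using path_in_edges path_edges_subset by (fastforce simp: subgraph_on_def)

lemma arc_from_to:
  assumes "(x, y) \<in> E"
  obtains g where "arc g" "path_image g = path_image (crv {x, y})" "pathstart g = pt x" "pathfinish g = pt y"
proof -
  have a: "arc (crv {x, y})" "arc (reversepath (crv {x, y}))"
    using edge_crv(1)[OF edgeI[OF assms]] by (auto simp: arc_reversepath)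
  from edge_crv(2)[OF edgeI[OF assms]]
  consider "pathstart (crv {x, y}) = pt x" "pathfinish (crv {x, y}) = pt y"
    | "pathstart (crv {x, y}) = pt y" "pathfinish (crv {x, y}) = pt x"
    by (auto simp: doubleton_eq_iff)
  then show ?thesis
    using that a by cases (metis, metis pathstart_reversepath pathfinish_reversepath path_image_reversepath)
qed

lemma subgraph_on_edge: "(x, y) \<in> E \<Longrightarrow> subgraph_on {x, y} {{x, y}}"
  using E_V by (auto simp: subgraph_on_def edges_def)

lemma drawn_edge: "(x, y) \<in> E \<Longrightarrow> drawn {x, y} {{x, y}} = path_image (crv {x, y})"
  using ends_in_crv[of "{x, y}"] by (auto simp: drawn_def edges_def)

lemma drawn_path_arc:
  assumes "path_in E xs" "set xs \<subseteq> V" "length xs \<ge> 2"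
  shows "\<exists>g. arc g \<and> path_image g = drawn (set xs) (path_edges xs) \<and>
    pathstart g = pt (hd xs) \<and> pathfinish g = pt (last xs)"
  using assms
proof (induction xs rule: path_edges.induct)
  case (1 x y xs)
  have xy: "(x, y) \<in> E" and rest: "path_in E (y # xs)" and x: "x \<notin> set (y # xs)"
    using 1(2) by (auto simp: path_in_def)
  obtain e where e: "arc e" "path_image e = path_image (crv {x, y})" "pathstart e = pt x" "pathfinish e = pt y"
    using arc_from_to[OF xy] .
  show ?case
  proof (cases "xs = []")
    case True
    then show ?thesis
      using e drawn_edge[OF xy] by (intro exI[of _ e]) simp
  next
    case False
    then obtain g where g: "arc g" "path_image g = drawn (set (y # xs)) (path_edges (y # xs))"
        "pathstart g = pt y" "pathfinish g = pt (last (y # xs))"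
      using 1 rest by (cases xs) auto
    have "path_image e \<inter> path_image g
        = drawn ({x, y} \<inter> set (y # xs)) ({{x, y}} \<inter> path_edges (y # xs))"
      unfolding e(2) g(2) drawn_edge[OF xy, symmetric]
      using subgraph_on_edge[OF xy] subgraph_on_path[OF rest] 1(3) by (intro drawn_Int) auto
    also have "{x, y} \<inter> set (y # xs) = {y}"
      using x by auto
    also have "{{x, y}} \<inter> path_edges (y # xs) = {}"
      using x path_edges_subset[of "{x, y}" "y # xs"] by auto
    finally have "path_image e \<inter> path_image g = {pt y}"
      by (simp add: drawn_def)
    then have "arc (e +++ g)"
      using e g by (intro arc_join) auto
    moreover have "path_image (e +++ g) = drawn (set (x # y # xs)) (path_edges (x # y # xs))"
      using e g ends_in_crv[of "{x, y}"] xy by (auto simp: path_image_join drawn_def edges_def)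
    ultimately show ?thesis
      using e g by (intro exI[of _ "e +++ g"]) simp
  qed
qed auto

lemma connected_drawn_path:
  assumes "path_in E xs" "set xs \<subseteq> V"
  shows "Topological_Spaces.connected (drawn (set xs) (path_edges xs))"
proof (cases "length xs \<ge> 2")
  case True
  then show ?thesis
    using drawn_path_arc[OF assms] connected_arc_image by metis
next
  case False
  then obtain x where "xs = [x]"
    using assms(1) by (cases xs; cases "tl xs") (auto simp: path_in_def)
  then show ?thesis
    by (simp add: drawn_def)
qed

lemma drawn_cycle:
  assumes "path_in E xs" "set xs \<subseteq> V" "length xs \<ge> 3" "(last xs, hd xs) \<in> E"
  obtains c where "simple_path c" "pathfinish c = pathstart c"
    "path_image c = drawn (set xs) (insert {last xs, hd xs} (path_edges xs))"
    "subgraph_on (set xs) (insert {last xs, hd xs} (path_edges xs))"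
proof -
  let ?e = "{last xs, hd xs}"
  obtain g where g: "arc g" "path_image g = drawn (set xs) (path_edges xs)"
      "pathstart g = pt (hd xs)" "pathfinish g = pt (last xs)"
    using drawn_path_arc[OF assms(1,2)] assms(3) by auto
  obtain e where e: "arc e" "path_image e = path_image (crv ?e)"
      "pathstart e = pt (last xs)" "pathfinish e = pt (hd xs)"
    using arc_from_to[OF assms(4)] .
  have in_xs: "hd xs \<in> set xs" "last xs \<in> set xs"
    using assms(3) by (auto intro!: hd_in_set last_in_set)
  have sub: "subgraph_on (set xs) (path_edges xs)"
    using subgraph_on_path[OF assms(1,2)] .
  have "path_image g \<inter> path_image e = drawn (set xs \<inter> ?e) (path_edges xs \<inter> {?e})"
    unfolding g(2) e(2) drawn_edge[OF assms(4), symmetric]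
    using sub subgraph_on_edge[OF assms(4)] by (rule drawn_Int)
  also have "path_edges xs \<inter> {?e} = {}"
    using closing_edge_notin_path_edges assms(1,3) by (auto simp: path_in_def)
  finally have "path_image g \<inter> path_image e \<subseteq> {pathstart g, pathstart e}"
    using e g by (auto simp: drawn_def)
  then have "simple_path (g +++ e)"
    using g e by (intro simple_path_join_loop) auto
  moreover have "path_image (g +++ e) = drawn (set xs) (insert ?e (path_edges xs))"
    using g e by (auto simp: path_image_join drawn_def)
  moreover have "subgraph_on (set xs) (insert ?e (path_edges xs))"
    using sub assms(4) in_xs by (auto simp: subgraph_on_def edges_def)
  ultimately show ?thesis
    using that[of "g +++ e"] g e by simp
qed

lemma drawn_mono: "D \<subseteq> D' \<Longrightarrow> F \<subseteq> F' \<Longrightarrow> drawn D F \<subseteq> drawn D' F'"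
  by (auto simp: drawn_def)

lemma region_Int: "D \<subseteq> V \<Longrightarrow> D' \<subseteq> V \<Longrightarrow> region D \<inter> region D' = region (D \<inter> D')"
proof -
  assume "D \<subseteq> V" "D' \<subseteq> V"
  moreover have "induced_edges D \<inter> induced_edges D' = induced_edges (D \<inter> D')"
    by (auto simp: induced_edges_def)
  ultimately show ?thesis
    unfolding region_def by (simp add: drawn_Int subgraph_on_induced_edges)
qed

lemma drawn_Un: "drawn (D \<union> D') (F \<union> F') = drawn D F \<union> drawn D' F'"
  by (auto simp: drawn_def)

section \<open>Excluded minors of plane graphs\<close>

text \<open>
  The cycle \<open>xs\<close> runs through \<open>K1\<close>, \<open>L1\<close>, \<open>K2\<close>, \<open>L2\<close> and is drawn as a Jordan curve. The drawing
  of \<open>K3 \<union> L3\<close> is connected and avoids it. Adding \<open>K3\<close> to \<open>L1\<close> and \<open>L2\<close>, and \<open>L3\<close> to \<open>K1\<close> and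
  \<open>K2\<close>, gives connections between opposite parts of the curve that cross each other; each
  of the four sets meets the curve in a connected segment, as \<open>no_crossing_connections\<close> demands.
\<close>

lemma no_K33_minor:
  assumes conn: "connected_in E K1" "connected_in E K2" "connected_in E K3"
      "connected_in E L1" "connected_in E L2" "connected_in E L3"
    and V: "K1 \<subseteq> V" "K2 \<subseteq> V" "K3 \<subseteq> V" "L1 \<subseteq> V" "L2 \<subseteq> V" "L3 \<subseteq> V"
    and KK: "K1 \<inter> K2 = {}" "K1 \<inter> K3 = {}" "K2 \<inter> K3 = {}"
    and LL: "L1 \<inter> L2 = {}" "L1 \<inter> L3 = {}" "L2 \<inter> L3 = {}"
    and KL: "(K1 \<union> K2 \<union> K3) \<inter> (L1 \<union> L2 \<union> L3) = {}"
    and adj: "\<And>K L. K \<in> {K1, K2, K3} \<Longrightarrow> L \<in> {L1, L2, L3} \<Longrightarrow> \<exists>u\<in>K. \<exists>v\<in>L. (u, v) \<in> E"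
  shows False
proof -
  have sym: "(v, u) \<in> E" if "(u, v) \<in> E" for u v
    using symD[OF sym_E that] .
  obtain a1 b1 where e1: "a1 \<in> K1" "b1 \<in> L1" "(a1, b1) \<in> E"
    using adj[of K1 L1] by blast
  obtain c1 b2 where e2: "c1 \<in> K2" "b2 \<in> L1" "(b2, c1) \<in> E"
    using adj[of K2 L1] sym by blast
  obtain c2 d1 where e3: "c2 \<in> K2" "d1 \<in> L2" "(c2, d1) \<in> E"
    using adj[of K2 L2] by blast
  obtain a2 d2 where e4: "a2 \<in> K1" "d2 \<in> L2" "(d2, a2) \<in> E"
    using adj[of K1 L2] sym by blast
  obtain p1 where p1: "path_in E p1" "set p1 \<subseteq> K1" "hd p1 = a2" "last p1 = a1"
    using connected_in_path[OF conn(1) e4(1) e1(1)] .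
  obtain p2 where p2: "path_in E p2" "set p2 \<subseteq> L1" "hd p2 = b1" "last p2 = b2"
    using connected_in_path[OF conn(4) e1(2) e2(2)] .
  obtain p3 where p3: "path_in E p3" "set p3 \<subseteq> K2" "hd p3 = c1" "last p3 = c2"
    using connected_in_path[OF conn(2) e2(1) e3(1)] .
  obtain p4 where p4: "path_in E p4" "set p4 \<subseteq> L2" "hd p4 = d1" "last p4 = d2"
    using connected_in_path[OF conn(5) e3(2) e4(2)] .
  have ne: "p1 \<noteq> []" "p2 \<noteq> []" "p3 \<noteq> []" "p4 \<noteq> []"
    using p1 p2 p3 p4 by (auto simp: path_in_def)
  define xs where "xs = p1 @ p2 @ p3 @ p4"
  have p34: "path_in E (p3 @ p4)"
    using p3 p4 e3 KL by (intro path_in_append[of E p3 p4]) auto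
  have p234: "path_in E (p2 @ p3 @ p4)"
  proof (rule path_in_append[OF p2(1) p34])
    show "set p2 \<inter> set (p3 @ p4) = {}"
      using p2 p3 p4 KL LL by auto
  qed (use p2 p3 e2 ne in simp)
  have xs: "path_in E xs"
    unfolding xs_def
  proof (rule path_in_append[OF p1(1) p234])
    show "set p1 \<inter> set (p2 @ p3 @ p4) = {}"
      using p1 p2 p3 p4 KL KK by auto
  qed (use p1 p2 e1 ne in simp)
  have set_xs: "set xs = set p1 \<union> set p2 \<union> set p3 \<union> set p4"
    by (auto simp: xs_def)
  have hd_last: "hd xs = a2" "last xs = d2"
    using ne p1 p4 by (auto simp: xs_def)
  have len: "length xs \<ge> 3"
  proof -
    have "length p1 \<ge> 1" "length p2 \<ge> 1" "length p3 \<ge> 1"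
      using ne by (auto simp: Suc_le_eq)
    then show ?thesis
      by (simp add: xs_def)
  qed
  define F where "F = path_edges p1 \<union> path_edges p2 \<union> path_edges p3 \<union> path_edges p4
    \<union> {{a1, b1}, {b2, c1}, {c2, d1}, {d2, a2}}"
  have F: "insert {last xs, hd xs} (path_edges xs) = F"
    unfolding hd_last unfolding xs_def F_def using ne p1 p2 p3 p4
    by (simp add: path_edges_append insert_commute Un_ac)
  have "set xs \<subseteq> V" "(last xs, hd xs) \<in> E"
    using V p1 p2 p3 p4 e4 by (auto simp: set_xs hd_last)
  then obtain c where c: "simple_path c" "pathfinish c = pathstart c"
      "path_image c = drawn (set xs) F" "subgraph_on (set xs) F"
    using drawn_cycle[OF xs _ len] unfolding F by blast
  let ?J = "path_image c"
  have meet: "?J \<inter> region D = drawn (set xs \<inter> D) {e \<in> F. e \<subseteq> D}" if "D \<subseteq> V" for D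
  proof -
    have "F \<inter> induced_edges D = {e \<in> F. e \<subseteq> D}"
      using c(4) by (auto simp: induced_edges_def subgraph_on_def)
    then show ?thesis
      unfolding c(3) region_def using drawn_Int[OF c(4) subgraph_on_induced_edges[OF that]] by simp
  qed
  have in_part: "e \<subseteq> set p" "e \<noteq> {}" if "e \<in> path_edges p" for e and p :: "'a list"
    using that path_edges_subset path_edges_nonempty by blast+
  \<comment> \<open>An edge of the cycle lies in one of the four segments or links a \<open>K\<close> to an \<open>L\<close>. This determines
    which cycle edges a union of branch sets can contain.\<close>
  have F_in: "e \<in> path_edges p1 \<and> D \<inter> K1 \<noteq> {} \<or> e \<in> path_edges p2 \<and> D \<inter> L1 \<noteq> {} \<or>
      e \<in> path_edges p3 \<and> D \<inter> K2 \<noteq> {} \<or> e \<in> path_edges p4 \<and> D \<inter> L2 \<noteq> {} \<or>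
      D \<inter> (K1 \<union> K2) \<noteq> {} \<and> D \<inter> (L1 \<union> L2) \<noteq> {}"
    if e: "e \<in> F" "e \<subseteq> D" for e D
  proof -
    have "D \<inter> S \<noteq> {}" if "e \<in> path_edges p" "set p \<subseteq> S" for p S
      using in_part[OF that(1)] that(2) e(2) by blast
    then show ?thesis
      using e e1 e2 e3 e4 p1(2) p2(2) p3(2) p4(2) unfolding F_def by blast
  qed
  have piece: "?J \<inter> region D = drawn (set p) (path_edges p)"
    if "D \<subseteq> V" "set p \<subseteq> D" "set p \<subseteq> set xs" "path_edges p \<subseteq> F"
      "set xs \<inter> D \<subseteq> set p" "\<And>e. e \<in> F \<Longrightarrow> e \<subseteq> D \<Longrightarrow> e \<in> path_edges p" for D p
  proof -
    have "{e \<in> F. e \<subseteq> D} = path_edges p"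
      using that(2,4,6) in_part(1) by blast
    moreover have "set xs \<inter> D = set p"
      using that(2,3,5) by blast
    ultimately show ?thesis
      using meet[OF that(1)] by simp
  qed
  have J1: "?J \<inter> region (L1 \<union> K3) = drawn (set p2) (path_edges p2)"
  proof (rule piece)
    show "e \<in> path_edges p2" if "e \<in> F" "e \<subseteq> L1 \<union> K3" for e
      using F_in[OF that] KL KK LL by blast
    show "set xs \<inter> (L1 \<union> K3) \<subseteq> set p2"
      using p1(2) p2(2) p3(2) p4(2) KL KK LL unfolding set_xs by blast
  qed (use V p2(2) in \<open>auto simp: F_def set_xs\<close>)
  have J2: "?J \<inter> region (L2 \<union> K3) = drawn (set p4) (path_edges p4)"
  proof (rule piece)
    show "e \<in> path_edges p4" if "e \<in> F" "e \<subseteq> L2 \<union> K3" for e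
      using F_in[OF that] KL KK LL by blast
    show "set xs \<inter> (L2 \<union> K3) \<subseteq> set p4"
      using p1(2) p2(2) p3(2) p4(2) KL KK LL unfolding set_xs by blast
  qed (use V p4(2) in \<open>auto simp: F_def set_xs\<close>)
  have J3: "?J \<inter> region (K1 \<union> L3) = drawn (set p1) (path_edges p1)"
  proof (rule piece)
    show "e \<in> path_edges p1" if "e \<in> F" "e \<subseteq> K1 \<union> L3" for e
      using F_in[OF that] KL KK LL by blast
    show "set xs \<inter> (K1 \<union> L3) \<subseteq> set p1"
      using p1(2) p2(2) p3(2) p4(2) KL KK LL unfolding set_xs by blast
  qed (use V p1(2) in \<open>auto simp: F_def set_xs\<close>)
  have J4: "?J \<inter> region (K2 \<union> L3) = drawn (set p3) (path_edges p3)"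
  proof (rule piece)
    show "e \<in> path_edges p3" if "e \<in> F" "e \<subseteq> K2 \<union> L3" for e
      using F_in[OF that] KL KK LL by blast
    show "set xs \<inter> (K2 \<union> L3) \<subseteq> set p3"
      using p1(2) p2(2) p3(2) p4(2) KL KK LL unfolding set_xs by blast
  qed (use V p3(2) in \<open>auto simp: F_def set_xs\<close>)
  have conn2: "connected_in E (K \<union> L)" if "K \<in> {K1, K2, K3}" "L \<in> {L1, L2, L3}" for K L
    using adj[OF that] that conn connected_in_Un[OF sym_E, of K L] by blast
  have nonempty: "drawn (set p) H \<noteq> {}" if "p \<noteq> []" for p :: "'a list" and H
    using that by (auto simp: drawn_def)
  have in_region: "region A \<inter> region B \<inter> region C \<noteq> {}"
    if "connected_in E D" "D \<subseteq> A" "D \<subseteq> B" "D \<subseteq> C" for A B C D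
    using connected_in_nonempty[OF that(1)] that(2-) by (fastforce simp: region_def drawn_def)
  \<comment> \<open>The links between the segments run from \<open>K1\<close> or \<open>K2\<close> to \<open>L1\<close> or \<open>L2\<close>. Hence \<open>P\<close> and \<open>Q\<close> cover the
    curve and overlap only in its two segments inside \<open>L1\<close> and \<open>L2\<close>.\<close>
  define P where "P = ?J \<inter> region (K1 \<union> L1 \<union> L2)"
  define Q where "Q = ?J \<inter> region (K2 \<union> L1 \<union> L2)"
  have "compact ?J"
    using c(1) by (simp add: compact_path_image simple_path_imp_path)
  show False
  proof (rule no_crossing_connections[OF c(1,2), of P Q "region (L1 \<union> K3)" "region (L2 \<union> K3)"
        "region (K1 \<union> L3)" "region (K2 \<union> L3)" "region (K3 \<union> L3)"])
    show "?J = P \<union> Q"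
    proof -
      have "e \<subseteq> K1 \<union> L1 \<union> L2 \<or> e \<subseteq> K2 \<union> L1 \<union> L2" if "e \<in> F" for e
        using that in_part(1)[of e] p1(2) p2(2) p3(2) p4(2) e1 e2 e3 e4 unfolding F_def by blast
      then have "F \<subseteq> induced_edges (K1 \<union> L1 \<union> L2) \<union> induced_edges (K2 \<union> L1 \<union> L2)"
        using c(4) unfolding induced_edges_def subgraph_on_def by blast
      moreover have "set xs \<subseteq> (K1 \<union> L1 \<union> L2) \<union> (K2 \<union> L1 \<union> L2)"
        using p1(2) p2(2) p3(2) p4(2) unfolding set_xs by blast
      ultimately have "drawn (set xs) F \<subseteq> region (K1 \<union> L1 \<union> L2) \<union> region (K2 \<union> L1 \<union> L2)"
        unfolding region_def drawn_Un[symmetric] by (intro drawn_mono)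
      then show ?thesis
        unfolding P_def Q_def c(3) by blast
    qed
    show "closed P" "closed Q"
      unfolding P_def Q_def using \<open>compact ?J\<close> V
      by (auto intro!: compact_imp_closed compact_Int compact_region)
    show "P \<inter> Q \<subseteq> region (L1 \<union> K3) \<union> region (L2 \<union> K3)"
    proof -
      have "(K1 \<union> L1 \<union> L2) \<inter> (K2 \<union> L1 \<union> L2) = L1 \<union> L2"
        using KK KL by blast
      then have "P \<inter> Q \<subseteq> ?J \<inter> region (L1 \<union> L2)"
        unfolding P_def Q_def using region_Int[of "K1 \<union> L1 \<union> L2" "K2 \<union> L1 \<union> L2"] V by auto
      also have "\<dots> = drawn (set xs \<inter> (L1 \<union> L2)) {e \<in> F. e \<subseteq> L1 \<union> L2}"
        using V by (intro meet) auto
      also have "\<dots> \<subseteq> drawn (set p2 \<union> set p4) (path_edges p2 \<union> path_edges p4)"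
      proof (rule drawn_mono)
        show "set xs \<inter> (L1 \<union> L2) \<subseteq> set p2 \<union> set p4"
          using p1(2) p3(2) KL unfolding set_xs by blast
        show "{e \<in> F. e \<subseteq> L1 \<union> L2} \<subseteq> path_edges p2 \<union> path_edges p4"
          using F_in[of _ "L1 \<union> L2"] KL by blast
      qed
      also have "\<dots> \<subseteq> region (L1 \<union> K3) \<union> region (L2 \<union> K3)"
        unfolding drawn_Un using J1 J2 by blast
      finally show ?thesis .
    qed
    show "compact (region (L1 \<union> K3))" "compact (region (L2 \<union> K3))"
      using V by (auto intro: compact_region)
    show "Topological_Spaces.connected (region (L1 \<union> K3))"
      "Topological_Spaces.connected (region (L2 \<union> K3))"
      "Topological_Spaces.connected (region (K1 \<union> L3))"
      "Topological_Spaces.connected (region (K2 \<union> L3))"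
      "Topological_Spaces.connected (region (K3 \<union> L3))"
      using conn2[of K3 L1] conn2[of K3 L2] conn2[of K1 L3] conn2[of K2 L3] conn2[of K3 L3] V
      by (auto intro!: connected_region simp: Un_commute)
    show "Topological_Spaces.connected (?J \<inter> region (L1 \<union> K3))"
      "Topological_Spaces.connected (?J \<inter> region (L2 \<union> K3))"
      "Topological_Spaces.connected (?J \<inter> region (K1 \<union> L3))"
      "Topological_Spaces.connected (?J \<inter> region (K2 \<union> L3))"
      unfolding J1 J2 J3 J4 using p1(2) p2(2) p3(2) p4(2) V
      by (intro connected_drawn_path p1(1) p2(1) p3(1) p4(1); blast)+
    show "region (K1 \<union> L3) \<inter> ?J \<noteq> {}" "region (K2 \<union> L3) \<inter> ?J \<noteq> {}"
      using J3 J4 nonempty[OF ne(1)] nonempty[OF ne(3)] by (auto simp: Int_commute)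
    show "region (K3 \<union> L3) \<inter> ?J = {}"
      unfolding c(3) region_def using V p1(2) p2(2) p3(2) p4(2) KK LL KL
      by (intro drawn_disjoint subgraph_on_induced_edges c(4)) (auto simp: set_xs)
    show "region (K3 \<union> L3) \<inter> region (L1 \<union> K3) \<inter> region (L2 \<union> K3) \<noteq> {}"
      by (rule in_region[OF conn(3)]) auto
    show "region (K3 \<union> L3) \<inter> region (K1 \<union> L3) \<inter> region (K2 \<union> L3) \<noteq> {}"
      by (rule in_region[OF conn(6)]) auto
    have apart: "K1 \<inter> L1 = {}" "K1 \<inter> L2 = {}" "L3 \<inter> K2 = {}" "K2 \<inter> L1 = {}" "K2 \<inter> L2 = {}"
        "L3 \<inter> K1 = {}" "L3 \<inter> K3 = {}" "K1 \<inter> K2 = {}" "K2 \<inter> K1 = {}" "K1 \<inter> K3 = {}" "K2 \<inter> K3 = {}"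
        "L3 \<inter> L1 = {}" "L3 \<inter> L2 = {}"
      using KL KK LL by auto
    have far: "region A \<inter> region B = {}" if "A \<subseteq> V" "B \<subseteq> V" "A \<inter> B = {}" for A B
      using that by (rule region_disjoint)
    have "region (K1 \<union> L3) \<inter> region (K2 \<union> L1 \<union> L2) = {}"
      "region (K1 \<union> L3) \<inter> region (L1 \<union> K3) = {}" "region (K1 \<union> L3) \<inter> region (L2 \<union> K3) = {}"
      using V by (intro far; simp add: apart Int_Un_distrib Int_Un_distrib2)+
    then show "region (K1 \<union> L3) \<inter> (Q \<union> region (L1 \<union> K3) \<union> region (L2 \<union> K3)) = {}"
      unfolding Q_def by blast
    have "region (K2 \<union> L3) \<inter> region (K1 \<union> L1 \<union> L2) = {}"
      "region (K2 \<union> L3) \<inter> region (L1 \<union> K3) = {}" "region (K2 \<union> L3) \<inter> region (L2 \<union> K3) = {}"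
      using V by (intro far; simp add: apart Int_Un_distrib Int_Un_distrib2)+
    then show "region (K2 \<union> L3) \<inter> (P \<union> region (L1 \<union> K3) \<union> region (L2 \<union> K3)) = {}"
      unfolding P_def by blast
  qed
qed

lemma no_K6_minor:
  assumes model: "clique_model E \<C>" and V: "\<Union>\<C> \<subseteq> V"
  shows "card \<C> \<noteq> 6"
proof
  assume card: "card \<C> = 6"
  then obtain Cs where Cs: "set Cs = \<C>" "distinct Cs"
    using finite_distinct_list[of \<C>] card.infinite[of \<C>] by force
  then have "length Cs = 6"
    using card distinct_card[of Cs] by simp
  then obtain K1 K2 K3 L1 L2 L3 where Cs_eq: "Cs = [K1, K2, K3, L1, L2, L3]"
    by (auto simp: numeral_eq_Suc length_Suc_conv)
  have C: "\<C> = {K1, K2, K3, L1, L2, L3}"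
    using Cs(1) unfolding Cs_eq by simp
  have neq: "K1 \<noteq> K2" "K1 \<noteq> K3" "K2 \<noteq> K3" "L1 \<noteq> L2" "L1 \<noteq> L3" "L2 \<noteq> L3"
    using Cs(2) unfolding Cs_eq by simp_all
  have "{K1, K2, K3} \<inter> {L1, L2, L3} = {}"
    using Cs(2) unfolding Cs_eq by simp
  then have neqKL: "K \<noteq> L" if "K \<in> {K1, K2, K3}" "L \<in> {L1, L2, L3}" for K L
    using that by (meson disjoint_iff)
  have disj: "A \<inter> B = {}" if "A \<in> \<C>" "B \<in> \<C>" "A \<noteq> B" for A B
    using model that by (auto simp: clique_model_def pairwise_def disjnt_def)
  show False
  proof (rule no_K33_minor[of K1 K2 K3 L1 L2 L3])
    show "connected_in E K1" "connected_in E K2" "connected_in E K3"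
      "connected_in E L1" "connected_in E L2" "connected_in E L3"
      using model by (auto simp: clique_model_def C)
    show "K1 \<subseteq> V" "K2 \<subseteq> V" "K3 \<subseteq> V" "L1 \<subseteq> V" "L2 \<subseteq> V" "L3 \<subseteq> V"
      using V by (auto simp: C)
    show "K1 \<inter> K2 = {}" "K1 \<inter> K3 = {}" "K2 \<inter> K3 = {}" "L1 \<inter> L2 = {}" "L1 \<inter> L3 = {}" "L2 \<inter> L3 = {}"
      using neq by (intro disj; simp add: C)+
    have "K \<inter> L = {}" if "K \<in> {K1, K2, K3}" "L \<in> {L1, L2, L3}" for K L
      using neqKL[OF that] that by (intro disj) (auto simp: C)
    then have "\<Union>{K1, K2, K3} \<inter> \<Union>{L1, L2, L3} = {}"
      by blast
    then show "(K1 \<union> K2 \<union> K3) \<inter> (L1 \<union> L2 \<union> L3) = {}"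
      by (simp add: Un_assoc)
    show "\<exists>u\<in>K. \<exists>v\<in>L. (u, v) \<in> E" if KL: "K \<in> {K1, K2, K3}" "L \<in> {L1, L2, L3}" for K L
    proof -
      have "K \<in> \<C>" "L \<in> \<C>"
        using KL by (auto simp: C)
      then show ?thesis
        using model neqKL[OF KL] by (auto simp: clique_model_def pairwise_def)
    qed
  qed
qed

end

section \<open>Longest path transversals of planar graphs\<close>

lemma set_vwalk_arcs_subset_iff:
  "set (vwalk_arcs p) \<subseteq> R \<longleftrightarrow> successively (\<lambda>x y. (x, y) \<in> R) p"
  by (induction p rule: vwalk_arcs.induct) auto

lemma vpath_iff_path_in: "vpath p G \<longleftrightarrow> path_in (arcs_ends G) p \<and> set p \<subseteq> verts G"
  by (auto simp: vpath_def vwalk_def path_in_def set_vwalk_arcs_subset_iff)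

lemma connected_in_verts:
  assumes "graph G" "Digraph_Component.connected G"
  shows "connected_in (arcs_ends G) (verts G)"
proof -
  interpret graph G
    by (rule assms(1))
  have reach: "u \<rightarrow>\<^sup>*\<^bsub>G\<^esub> v" if "u \<in> verts G" "v \<in> verts G" for u v
    using assms(2) that reachable_mk_symmetric_eq[OF sym_arcs]
    by (auto simp: Digraph_Component.connected_def strongly_connected_def)
  have "verts G \<noteq> {}"
    using assms(2) by (auto simp: Digraph_Component.connected_def strongly_connected_def)
  then obtain r where r: "r \<in> verts G"
    by blast
  show ?thesis
  proof (rule connected_inI[OF _ r])
    show "sym (arcs_ends G)"
      using sym_arcs by (simp add: symmetric_def)
    fix P assume P: "P \<subseteq> verts G" "r \<in> P" "arcs_ends G `` P \<inter> verts G \<subseteq> P"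
    have "v \<in> P" if "(r, v) \<in> rtrancl_on (verts G) (arcs_ends G)" for v
      using that by (induction rule: rtrancl_on_induct) (use P in auto)
    then show "P = verts G"
      using P(1) reach[OF r] unfolding reachable_def by blast
  qed
qed

text \<open>
  The dichotomy for intersecting families with \<open>h = 6\<close>, applied to the vertex sets of the longest
  paths.
\<close>

lemma planar_longest_path_transversal:
  assumes "graph G" "Digraph_Component.connected G" "planar G" "6 * card (verts G) \<le> t * t"
  obtains S where "longest_path_transversal S G" "card S \<le> 6 * t"
proof -
  obtain pt crv where "plane_drawing G pt crv"
    using assms(3) by (auto simp: planar_def)
  then interpret plane_graph G pt crv
    using assms(1) by (intro plane_graph.intro)
  let ?F = "{set p | p. longest_path p G}"
  have conn: "connected_in E (verts G)"
    using connected_in_verts[OF assms(1,2)] .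
  show ?thesis
  proof (rule bramble_hitting_set_or_clique_model[OF sym_E E_V finite_V assms(4), of ?F])
    show "connected_in E A \<and> A \<subseteq> V" if "A \<in> ?F" for A
      using that connected_in_path_set[OF sym_E] by (auto simp: longest_path_def vpath_iff_path_in)
    show "A \<inter> B \<noteq> {}" if "A \<in> ?F" "B \<in> ?F" for A B
      using that longest_paths_meet[OF sym_E conn]
      by (fastforce simp: longest_path_def vpath_iff_path_in)
  next
    fix X assume X: "X \<subseteq> V" "card X \<le> 6 * t" "\<And>A. A \<in> ?F \<Longrightarrow> A \<inter> X \<noteq> {}"
    have "X \<inter> set p \<noteq> {}" if "longest_path p G" for p
      using X(3)[of "set p"] that by (auto simp: Int_commute)
    then have "longest_path_transversal X G"
      using X(1) by (simp add: longest_path_transversal_def)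
    then show ?thesis
      using X(2) by (rule that)
  next
    fix \<C> assume "clique_model E \<C>" "\<Union>\<C> \<subseteq> V" "card \<C> = 6"
    then show ?thesis
      using no_K6_minor[of \<C>] by simp
  qed
qed

lemma lpt_le: "longest_path_transversal S G \<Longrightarrow> lpt G \<le> card S"
  unfolding lpt_def by (rule Least_le) blast

lemma longest_path_transversal_verts: "longest_path_transversal (verts G) G"
proof -
  have "verts G \<inter> set p \<noteq> {}" if "vpath p G" for p
    using that by (cases p) (auto simp: vpath_def vwalk_def)
  then show ?thesis
    by (auto simp: longest_path_transversal_def longest_path_def)
qed

theorem proposition5:
  fixes G :: "('a, 'b) pre_digraph"
  assumes "graph G" and "Digraph_Component.connected G" and "planar G"
    and "card (verts G) \<ge> 2"
  shows "real (lpt G) \<le> 9 * sqrt (real (card (verts G))) * ln (real (card (verts G)))"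
proof -
  define n where "n = real (card (verts G))"
  have n: "n \<ge> 2"
    using assms(4) by (simp add: n_def)
  have ln2: "ln 2 \<ge> (2 / 3 :: real)"
    using ln2_ge_two_thirds .
  show ?thesis
  \<comment> \<open>For \<open>n \<le> 36\<close> the trivial bound \<open>n\<close> suffices, as \<open>sqrt n \<le> 6 \<le> 9 * ln 2\<close>. Beyond that,
    \<open>6 * t \<le> 24 * sqrt n\<close> and \<open>9 * ln n \<ge> 9 * ln 32 \<ge> 30\<close>.\<close>
  proof (cases "n \<le> 36")
    case True
    have "sqrt n \<le> 6"
      using True real_sqrt_le_mono[of n 36] by simp
    also have "6 \<le> 9 * ln n"
      using ln2 ln_le_cancel_iff[of 2 n] n by linarith
    finally have "sqrt n * sqrt n \<le> sqrt n * (9 * ln n)"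
      using n by (intro mult_left_mono) auto
    then have "n \<le> 9 * sqrt n * ln n"
      using n by (simp add: mult_ac)
    moreover have "real (lpt G) \<le> n"
      using lpt_le[OF longest_path_transversal_verts[of G]] by (simp add: n_def)
    ultimately show ?thesis
      by (simp add: n_def)
  next
    case False
    define t where "t = nat \<lceil>sqrt (6 * n)\<rceil>"
    have t: "sqrt (6 * n) \<le> real t" "real t \<le> sqrt (6 * n) + 1"
      using n by (auto simp: t_def)
    have "6 * n \<le> real t * real t"
      using mult_mono[OF t(1) t(1)] n by simp
    then have "real (6 * card (verts G)) \<le> real (t * t)"
      by (simp add: n_def)
    then have "6 * card (verts G) \<le> t * t"
      by (simp only: of_nat_le_iff)
    then obtain S where S: "longest_path_transversal S G" "card S \<le> 6 * t"
      using planar_longest_path_transversal[OF assms(1-3)] by blast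
    have "real (lpt G) \<le> 6 * real t"
      using lpt_le[OF S(1)] S(2) by simp
    also have "\<dots> \<le> 6 * (3 * sqrt n + sqrt n)"
    proof -
      have one_le_sqrt: "1 \<le> sqrt n"
        using n by (intro real_sqrt_ge_one) simp
      have "sqrt (6 * n) \<le> sqrt (9 * n)"
        using n by (intro real_sqrt_le_mono) simp
      also have "\<dots> = 3 * sqrt n"
        by (simp add: real_sqrt_mult)
      finally have root_le: "sqrt (6 * n) \<le> 3 * sqrt n" .
      show ?thesis
        using mult_left_mono[OF order.trans[OF t(2) add_mono[OF root_le one_le_sqrt]], of 6] by simp
    qed
    also have "\<dots> \<le> 9 * sqrt n * (10 / 3)"
      using n by simp
    also have "\<dots> \<le> 9 * sqrt n * ln n"
    proof (rule mult_left_mono)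
      have "10 / 3 \<le> 5 * ln (2 :: real)"
        using ln2 by simp
      also have "\<dots> = ln (2 ^ 5)"
        by (simp only: ln_realpow)
      also have "\<dots> \<le> ln n"
        using False by (subst ln_le_cancel_iff) auto
      finally show "10 / 3 \<le> ln n" .
    qed (use n in simp)
    finally show ?thesis
      by (simp add: n_def)
  qed
qed

end
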